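(* Let $d\ge1$, let $\|\cdot\|$ be a norm on $\mathbb{R}^d$, let $\alpha>0$, and let $(\Theta_t)_{t\in\mathbb{Z}}$ be a stochastic process with values in $[0,\infty)^d$ which satisfies both Property (SC) and Property (TCF) with parameter $\alpha$. Let $(U_i,T_i,(\Theta_t^{(i)})_{t\in\mathbb{Z}})_{i\in\mathbb{N}}$ be an enumeration of the points of a Poisson point process on $(0,\infty)\times\mathbb{Z}\times([0,\infty)^d)^{\mathbb{Z}}$ with intensity $\alpha u^{-\alpha-1}\,du\otimes\lambda(dt)\otimes P^{(\Theta_t)_{t\in\mathbb{Z}}}(d\theta)$, where $\lambda$ is the counting measure on $\mathbb{Z}$ and $P^{(\Theta_t)_{t\in\mathbb{Z}}}$ is the law of $(\Theta_t)_{t\in\mathbb{Z}}$. Then the spectral tail process of $$(Z_t)_{t\in\mathbb{Z}}=\left(\bigvee_{i\in\mathbb{N}}U_i\,\frac{\Theta^{(i)}_{t+T_i}}{\|(\Theta^{(i)}_l)_{l\in\mathbb{Z}}\|_\alpha}\right)_{t\in\mathbb{Z}}$$ (maxima taken componentwise) is given by $(\Theta_t)_{t\in\mathbb{Z}}$.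
   Context: Notation: $\|(\theta_t)_{t\in\mathbb{Z}}\|_\alpha:=\left(\sum_{t\in\mathbb{Z}}\|\theta_t\|^\alpha\right)^{1/\alpha}$ (also for $\alpha<1$). Property (SC) (with parameter $\alpha$): $0<\sum_{t\in\mathbb{Z}}\|\Theta_t\|^\alpha<\infty$ almost surely. Property (TCF) (with parameter $\alpha>0$): an $\mathbb{R}^d$-valued time series $(\Theta_t)_{t\in\mathbb{Z}}$ satisfies Property (TCF) if $P(\|\Theta_0\|=1)=1$ and $$E\big(f(\Theta_{s-i},\dots,\Theta_{t-i})\big)=E\left(f\left(\frac{\Theta_s}{\|\Theta_i\|},\dots,\frac{\Theta_t}{\|\Theta_i\|}\right)\mathbf{1}_{\{\|\Theta_i\|>0\}}\|\Theta_i\|^\alpha\right)$$ for all integers $s\le 0\le t$, all $i\in\mathbb{Z}$ and all bounded continuous $f:(\mathbb{R}^d)^{t-s+1}\to\mathbb{R}$ such that $f(\theta_s,\dots,\theta_t)=0$ whenever $\theta_0=0$ (the expression inside the right-hand expectation is $0$ where $\|\Theta_i\|=0$). Spectral tail process: for a stationary $\mathbb{R}^d$-valued time series $(X_t)_{t\in\mathbb{Z}}$, a time series $(\Theta_t)_{t\in\mathbb{Z}}$ such that for all integers $s\le t$, the conditional law of $(X_s/\|X_0\|,\dots,X_t/\|X_0\|)$ given $\|X_0\|>x$ converges weakly to the law of $(\Theta_s,\dots,\Theta_t)$ as $x\to\infty$. *)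

theory Defs
  imports "HOL-Probability.Probability"
begin

definition norm_on_Rd :: "(real^'n \<Rightarrow> real) \<Rightarrow> bool" where
  "norm_on_Rd nrm \<longleftrightarrow>
     (\<forall>x. 0 \<le> nrm x) \<and> (\<forall>x. nrm x = 0 \<longleftrightarrow> x = 0) \<and>
     (\<forall>c x. nrm (c *\<^sub>R x) = \<bar>c\<bar> * nrm x) \<and> (\<forall>x y. nrm (x + y) \<le> nrm x + nrm y)"

definition nonneg_borel :: "(real^'n) measure" where
  "nonneg_borel = restrict_space borel {x. \<forall>j. 0 \<le> x $ j}"

definition time_series :: "'a measure \<Rightarrow> (int \<Rightarrow> 'a \<Rightarrow> real^'n) \<Rightarrow> bool" where
  "time_series M X \<longleftrightarrow> prob_space M \<and> (\<forall>t. X t \<in> borel_measurable M)"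

definition stationary :: "'a measure \<Rightarrow> (int \<Rightarrow> 'a \<Rightarrow> real^'n) \<Rightarrow> bool" where
  "stationary M X \<longleftrightarrow> time_series M X \<and>
     (\<forall>h. distr M (\<Pi>\<^sub>M t\<in>UNIV. borel) (\<lambda>\<omega> t. X (t + h) \<omega>) =
          distr M (\<Pi>\<^sub>M t\<in>UNIV. borel) (\<lambda>\<omega> t. X t \<omega>))"

definition alpha_norm :: "(real^'n \<Rightarrow> real) \<Rightarrow> real \<Rightarrow> (int \<Rightarrow> real^'n) \<Rightarrow> real" where
  "alpha_norm nrm \<alpha> \<theta> = (\<Sum>\<^sub>\<infinity>t\<in>UNIV. nrm (\<theta> t) powr \<alpha>) powr (1 / \<alpha>)"

definition property_SC ::
  "(real^'n \<Rightarrow> real) \<Rightarrow> real \<Rightarrow> 'a measure \<Rightarrow> (int \<Rightarrow> 'a \<Rightarrow> real^'n) \<Rightarrow> bool" where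
  "property_SC nrm \<alpha> M \<Theta> \<longleftrightarrow>
     (AE \<omega> in M. (\<lambda>t. nrm (\<Theta> t \<omega>) powr \<alpha>) summable_on UNIV \<and>
                 0 < (\<Sum>\<^sub>\<infinity>t\<in>UNIV. nrm (\<Theta> t \<omega>) powr \<alpha>))"

text \<open>
  The space of blocks \<open>(\<theta>\<^sub>s, \<dots>, \<theta>\<^sub>t)\<close> is represented by the functions that are extensional on
  \<open>{s..t}\<close>, which are the points of both the product topology and the product measure space.
\<close>

definition block_topology :: "int \<Rightarrow> int \<Rightarrow> (int \<Rightarrow> real^'n) topology" where
  "block_topology s t = product_topology (\<lambda>_. euclidean) {s..t}"

definition block_space :: "int \<Rightarrow> int \<Rightarrow> (int \<Rightarrow> real^'n) measure" where
  "block_space s t = (\<Pi>\<^sub>M j\<in>{s..t}. borel)"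

definition bounded_continuous_map :: "'b topology \<Rightarrow> ('b \<Rightarrow> real) \<Rightarrow> bool" where
  "bounded_continuous_map T f \<longleftrightarrow> continuous_map T euclideanreal f \<and> bounded (f ` topspace T)"

text \<open>
  Integrability is required explicitly in (TCF) because the Bochner integral of a non-integrable
  function is \<open>0\<close>, whereas the identity of the expectations presupposes that they exist.
\<close>

definition property_TCF ::
  "(real^'n \<Rightarrow> real) \<Rightarrow> real \<Rightarrow> 'a measure \<Rightarrow> (int \<Rightarrow> 'a \<Rightarrow> real^'n) \<Rightarrow> bool" where
  "property_TCF nrm \<alpha> M \<Theta> \<longleftrightarrow>
     time_series M \<Theta> \<and> (AE \<omega> in M. nrm (\<Theta> 0 \<omega>) = 1) \<and>
     (\<forall>s t i. \<forall>f. s \<le> 0 \<longrightarrow> 0 \<le> t \<longrightarrow> bounded_continuous_map (block_topology s t) f \<longrightarrow>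
        (\<forall>\<theta> \<in> topspace (block_topology s t). \<theta> 0 = 0 \<longrightarrow> f \<theta> = 0) \<longrightarrow>
        (let g = (\<lambda>\<omega>. f (\<lambda>j\<in>{s..t}. \<Theta> j \<omega> /\<^sub>R nrm (\<Theta> i \<omega>)) *
                       indicator {\<omega>. nrm (\<Theta> i \<omega>) > 0} \<omega> * nrm (\<Theta> i \<omega>) powr \<alpha>)
         in integrable M g \<and>
            (\<integral>\<omega>. f (\<lambda>j\<in>{s..t}. \<Theta> (j - i) \<omega>) \<partial>M) = (\<integral>\<omega>. g \<omega> \<partial>M)))"

definition weakly_converges ::
  "'b topology \<Rightarrow> ('c \<Rightarrow> 'b measure) \<Rightarrow> 'b measure \<Rightarrow> 'c filter \<Rightarrow> bool" where
  "weakly_converges T \<mu> \<nu> F \<longleftrightarrow>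
     (\<forall>f. bounded_continuous_map T f \<longrightarrow>
        ((\<lambda>x. \<integral>y. f y \<partial>\<mu> x) \<longlongrightarrow> (\<integral>y. f y \<partial>\<nu>)) F)"

text \<open>
  \<^const>\<open>uniform_measure\<close> is the conditional probability measure given an event. If the event
  has probability \<open>0\<close> it is the zero measure, so the convergence below (tested with \<open>f = 1\<close>)
  forces \<open>P(nrm (X\<^sub>0) > x) > 0\<close> for every \<open>x\<close>.
\<close>

definition spectral_tail_process ::
  "(real^'n \<Rightarrow> real) \<Rightarrow> 'b measure \<Rightarrow> (int \<Rightarrow> 'b \<Rightarrow> real^'n) \<Rightarrow>
   'a measure \<Rightarrow> (int \<Rightarrow> 'a \<Rightarrow> real^'n) \<Rightarrow> bool" where
  "spectral_tail_process nrm N X M \<Theta> \<longleftrightarrow>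
     stationary N X \<and> time_series M \<Theta> \<and>
     (\<forall>s t. s \<le> t \<longrightarrow>
        weakly_converges (block_topology s t)
          (\<lambda>x. distr (uniform_measure N {\<omega> \<in> space N. nrm (X 0 \<omega>) > x}) (block_space s t)
                  (\<lambda>\<omega>. \<lambda>j\<in>{s..t}. X j \<omega> /\<^sub>R nrm (X 0 \<omega>)))
          (distr M (block_space s t) (\<lambda>\<omega>. \<lambda>j\<in>{s..t}. \<Theta> j \<omega>))
          at_top)"

definition point_count :: "(nat \<Rightarrow> 'b \<Rightarrow> 'e) \<Rightarrow> 'e set \<Rightarrow> 'b \<Rightarrow> ennreal" where
  "point_count V A \<omega> = emeasure (count_space UNIV) {i. V i \<omega> \<in> A}"

text \<open>
  \<open>V\<close> enumerates, with multiplicities, the points of a Poisson point process with intensity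
  measure \<open>\<mu>\<close>. An enumeration by all of \<^typ>\<open>nat\<close> is only possible if \<open>\<mu>\<close> has infinite total
  mass, as is the case for the intensity below. Finite disjoint families of sets are covered by
  padding with the empty set.
\<close>

definition poisson_points :: "'b measure \<Rightarrow> 'e measure \<Rightarrow> (nat \<Rightarrow> 'b \<Rightarrow> 'e) \<Rightarrow> bool" where
  "poisson_points N \<mu> V \<longleftrightarrow>
     prob_space N \<and> (\<forall>i. V i \<in> N \<rightarrow>\<^sub>M \<mu>) \<and>
     (\<forall>A \<in> sets \<mu>. emeasure \<mu> A < \<infinity> \<longrightarrow>
        (\<forall>k. measure N {\<omega> \<in> space N. point_count V A \<omega> = of_nat k} =
             exp (- measure \<mu> A) * measure \<mu> A ^ k / fact k)) \<and>
     (\<forall>A \<in> sets \<mu>. emeasure \<mu> A = \<infinity> \<longrightarrow> (AE \<omega> in N. point_count V A \<omega> = \<infinity>)) \<and>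
     (\<forall>A :: nat \<Rightarrow> 'e set. range A \<subseteq> sets \<mu> \<longrightarrow> disjoint_family A \<longrightarrow>
        prob_space.indep_vars N (\<lambda>_. borel) (\<lambda>n. point_count V (A n)) UNIV)"

definition path_law :: "'a measure \<Rightarrow> (int \<Rightarrow> 'a \<Rightarrow> real^'n) \<Rightarrow> (int \<Rightarrow> real^'n) measure" where
  "path_law M \<Theta> = distr M (\<Pi>\<^sub>M t\<in>UNIV. nonneg_borel) (\<lambda>\<omega> t. \<Theta> t \<omega>)"

definition intensity ::
  "real \<Rightarrow> 'a measure \<Rightarrow> (int \<Rightarrow> 'a \<Rightarrow> real^'n) \<Rightarrow> (real \<times> int \<times> (int \<Rightarrow> real^'n)) measure" where
  "intensity \<alpha> M \<Theta> =
     density (restrict_space lborel {0<..}) (\<lambda>u. ennreal (\<alpha> * u powr (- \<alpha> - 1))) \<Otimes>\<^sub>M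
     (count_space UNIV \<Otimes>\<^sub>M path_law M \<Theta>)"

text \<open>
  For a path \<open>\<theta>\<close> that is identically zero or has a divergent series of \<open>\<alpha>\<close>-th powers, \<open>alpha_norm\<close> is
  \<open>0\<close> and so is the storm. Under (SC) such paths are null sets of the path law, so almost surely no
  point of the Poisson process carries one.
\<close>

definition storm ::
  "(real^'n \<Rightarrow> real) \<Rightarrow> real \<Rightarrow> real \<Rightarrow> int \<Rightarrow> (int \<Rightarrow> real^'n) \<Rightarrow> int \<Rightarrow> real^'n" where
  "storm nrm \<alpha> u k \<theta> t = u *\<^sub>R (\<theta> (t + k) /\<^sub>R alpha_norm nrm \<alpha> \<theta>)"

text \<open>
  The supremum is that of \<^typ>\<open>real\<close>, hence meaningful only where the coordinates of the storms
  are bounded above.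
\<close>

definition max_process ::
  "(real^'n \<Rightarrow> real) \<Rightarrow> real \<Rightarrow> (nat \<Rightarrow> 'b \<Rightarrow> real) \<Rightarrow> (nat \<Rightarrow> 'b \<Rightarrow> int) \<Rightarrow>
   (nat \<Rightarrow> int \<Rightarrow> 'b \<Rightarrow> real^'n) \<Rightarrow> int \<Rightarrow> 'b \<Rightarrow> real^'n" where
  "max_process nrm \<alpha> U T \<Psi> t \<omega> =
     (\<chi> j. SUP i. storm nrm \<alpha> (U i \<omega>) (T i \<omega>) (\<lambda>l. \<Psi> i l \<omega>) t $ j)"

end

theory Submission
  imports Defs
begin

text \<open>
  Write \<open>Y(p)\<close> for the storm carried by a point \<open>p\<close> of the Poisson process and \<open>\<mu>\<close> for the intensity.
  Integrating out \<open>u\<close> and using (TCF) for each shift \<open>k\<close>, the sum over \<open>k\<close> collapses by (SC) to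
  \<open>\<mu>(\<parallel>Y\<^sub>0\<parallel> > x, Y / \<parallel>Y\<^sub>0\<parallel> \<in> D) = x\<^sup>-\<^sup>\<alpha> P(\<Theta> \<in> D)\<close>.
  Void probabilities and the shift invariance of \<open>\<mu>\<close> give stationarity. For the tail one uses a
  single big jump: the probability of two points of size at least \<open>\<epsilon>x\<close> near time \<open>0\<close> is
  \<open>O(x\<^sup>-\<^sup>2\<^sup>\<alpha>)\<close>, and if there is just one such point, then \<open>Z\<close> is \<open>\<epsilon>x\<close>-close to its storm, whose
  law is the normalised restriction of \<open>\<mu>\<close>. Only closeness, not monotonicity, is used because the norm need
  not be monotone on the positive orthant.
\<close>

text \<open>What makes the sum collapse is the functional
  \<open>nrm (\<theta> 0) powr \<alpha> / S \<theta>\<close>: it is invariant under scaling, so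
  (TCF) moves it through the normalisation, and its shifts add up to 1. In the tail estimate the
  error in \<open>Z\<close> is proportional to x, the test function is only bounded and continuous,
  and the norm by which one divides is itself perturbed. With no uniform modulus of continuity
  available, every discrepancy is charged to an event of the one big storm: its norm lies in a thin
  layer around x, or its normalised path lies in \<open>unstable\<close>. Both have an exactly known
  mass, since D may be any measurable set. These masses have the same order
  \<open>x powr (- \<alpha>)\<close> as the main term and shrink only with the relative error
  \<delta>, whereas several big points become negligible as x grows. Therefore \<delta> is fixed
  before x tends to infinity.\<close>

lemma Collect_vimage_sets:
  assumes "f \<in> M \<rightarrow>\<^sub>M K" "A \<in> sets K"
  shows "{x \<in> space M. f x \<in> A} \<in> sets M"
  using measurable_sets[OF assms] by (simp add: vimage_def Int_def conj_commute)

section \<open>Norms, path space and the ray measure\<close>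

text \<open>Expansion in the standard basis. This yields the continuity of \<open>nrm\<close> on
  which the compactness argument for the reverse estimate rests.\<close>

lemma norm_on_Rd_bound:
  fixes nrm :: "real^'n \<Rightarrow> real"
  assumes "norm_on_Rd nrm"
  shows "\<exists>c\<ge>0. \<forall>x. nrm x \<le> c * norm x"
proof (intro exI conjI allI)
  have sum_le: "nrm (\<Sum>j\<in>A. x j) \<le> (\<Sum>j\<in>A. nrm (x j))" if "finite A" for A :: "'n set" and x
    using that
  proof induction
    case empty
    from assms have "nrm 0 = 0" unfolding norm_on_Rd_def by blast
    then show ?case by simp
  next
    case (insert a A)
    have "nrm (x a + (\<Sum>j\<in>A. x j)) \<le> nrm (x a) + nrm (\<Sum>j\<in>A. x j)"
      using assms by (auto simp: norm_on_Rd_def)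
    with insert show ?case by simp
  qed
  show "0 \<le> (\<Sum>j\<in>UNIV. nrm (axis j 1))"
    using assms by (auto simp: norm_on_Rd_def intro!: sum_nonneg)
  fix x
  have "nrm x = nrm (\<Sum>j\<in>UNIV. x $ j *\<^sub>R axis j 1)"
    by (simp add: basis_expansion scalar_mult_eq_scaleR[symmetric])
  also have "\<dots> \<le> (\<Sum>j\<in>UNIV. nrm (x $ j *\<^sub>R axis j 1))"
    by (rule sum_le) simp
  also have "\<dots> = (\<Sum>j\<in>UNIV. \<bar>x $ j\<bar> * nrm (axis j 1))"
    using assms by (simp add: norm_on_Rd_def)
  also have "\<dots> \<le> (\<Sum>j\<in>UNIV. norm x * nrm (axis j 1))"
    using assms component_le_norm_cart[of x]
    by (intro sum_mono mult_right_mono) (auto simp: norm_on_Rd_def)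
  finally show "nrm x \<le> (\<Sum>j\<in>UNIV. nrm (axis j 1)) * norm x"
    by (simp add: sum_distrib_left mult.commute)
qed

lemma norm_on_Rd_diff:
  assumes "norm_on_Rd nrm"
  shows "\<bar>nrm x - nrm y\<bar> \<le> nrm (x - y)"
proof -
  have tri: "nrm (u + v) \<le> nrm u + nrm v" and hom: "nrm (c *\<^sub>R u) = \<bar>c\<bar> * nrm u" for u v c
    using assms by (auto simp: norm_on_Rd_def)
  show ?thesis
    using tri[of "x - y" y] tri[of "y - x" x] hom[of "-1" "x - y"] by simp
qed

lemma norm_on_Rd_continuous:
  fixes nrm :: "real^'n \<Rightarrow> real"
  assumes "norm_on_Rd nrm"
  shows "continuous_on S nrm"
proof -
  obtain c where c: "c \<ge> 0" "\<And>x. nrm x \<le> c * norm x"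
    using norm_on_Rd_bound[OF assms] by auto
  have "c-lipschitz_on UNIV nrm"
    using c norm_on_Rd_diff[OF assms]
    by (intro lipschitz_onI) (auto simp: dist_norm intro: order_trans)
  then show ?thesis
    using lipschitz_on_continuous_on continuous_on_subset by blast
qed

text \<open>The lower bound is compactness: \<open>nrm\<close> attains a positive minimum on the
  Euclidean unit sphere. The last clause is there because maxima are taken componentwise, so errors
  arrive coordinate by coordinate.\<close>

lemma norm_on_Rd_equivalent:
  fixes nrm :: "real^'n \<Rightarrow> real"
  assumes n: "norm_on_Rd nrm"
  obtains c where "c \<ge> 1" "\<And>x. nrm x \<le> c * norm x" "\<And>x. norm x \<le> c * nrm x"
    "\<And>x e. (\<And>j. \<bar>x $ j\<bar> \<le> e) \<Longrightarrow> nrm x \<le> c * e"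
proof -
  obtain c0 where c0: "c0 \<ge> 0" "\<And>x. nrm x \<le> c0 * norm x"
    using norm_on_Rd_bound[OF n] by auto
  have "\<exists>x\<in>sphere 0 1. \<forall>y\<in>sphere 0 1. nrm x \<le> nrm y"
    by (rule continuous_attains_inf)
      (auto intro: norm_on_Rd_continuous[OF n] exI[of _ "axis undefined 1"])
  then obtain x0 where x0: "norm x0 = 1" "\<And>y. norm y = 1 \<Longrightarrow> nrm x0 \<le> nrm y"
    by auto
  have pos: "nrm x0 > 0"
    using n x0(1) unfolding norm_on_Rd_def by (metis norm_zero order_le_less zero_neq_one)
  have lower: "norm x \<le> nrm x / nrm x0" for x
  proof (cases "x = 0")
    case True
    then show ?thesis using n by (simp add: norm_on_Rd_def)
  next
    case False
    then have "nrm x0 \<le> nrm ((1 / norm x) *\<^sub>R x)" by (intro x0(2)) simp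
    also have "\<dots> = nrm x / norm x" using n False by (simp add: norm_on_Rd_def)
    finally show ?thesis using False pos by (simp add: field_simps)
  qed
  \<comment> \<open>The sum of all constants, so that one \<open>c\<close> serves the four
    estimates.\<close>
  define c where "c = 1 + c0 + 1 / nrm x0 + c0 * real CARD('n)"
  have cs: "c \<ge> 1" "c0 \<le> c" "1 / nrm x0 \<le> c" "c0 * real CARD('n) \<le> c"
    using c0(1) pos by (auto simp: c_def)
  have nn: "0 \<le> nrm x" for x using n by (simp add: norm_on_Rd_def)
  show ?thesis
  proof
    show "c \<ge> 1" by fact
    show "nrm x \<le> c * norm x" for x
      using c0(2)[of x] mult_right_mono[OF cs(2), of "norm x"] by simp
    show "norm x \<le> c * nrm x" for x
      using lower[of x] mult_right_mono[OF cs(3) nn[of x]] by simp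
    show "nrm x \<le> c * e" if e: "\<And>j. \<bar>x $ j\<bar> \<le> e" for x e
    proof -
      have e0: "e \<ge> 0" using e[of undefined] by linarith
      have "norm x \<le> (\<Sum>j\<in>UNIV. \<bar>x $ j\<bar>)" by (rule norm_le_l1_cart)
      also have "\<dots> \<le> real CARD('n) * e" using e sum_bounded_above[of UNIV "\<lambda>j. \<bar>x $ j\<bar>" e] by simp
      finally have "c0 * norm x \<le> c0 * (real CARD('n) * e)" by (rule mult_left_mono) (rule c0(1))
      also have "\<dots> \<le> c * e" using mult_right_mono[OF cs(4) e0] by (simp add: mult.assoc)
      finally show ?thesis using c0(2)[of x] by linarith
    qed
  qed
qed

text \<open>Orthants in finitely many coordinates are stable under intersection and generate the
  product sigma-algebra; \<open>J = {}\<close> gives the whole space, so finite total mass suffices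
  for uniqueness. Used both to extend (TCF) and to compare the laws of shifted maxima.\<close>

lemma measure_eqI_PiM_atMost:
  fixes \<mu> \<nu> :: "('i \<Rightarrow> 'c::ordered_euclidean_space) measure"
  assumes sets: "sets \<mu> = sets (Pi\<^sub>M UNIV (\<lambda>_. borel))" "sets \<nu> = sets (Pi\<^sub>M UNIV (\<lambda>_. borel))"
    and fin: "emeasure \<mu> UNIV \<noteq> \<infinity>"
    and eq: "\<And>J z. finite J \<Longrightarrow> emeasure \<mu> {x. \<forall>j\<in>J. x j \<le> z j} = emeasure \<nu> {x. \<forall>j\<in>J. x j \<le> z j}"
  shows "\<mu> = \<nu>"
proof -
  define P where "P = {{f \<in> (\<Pi>\<^sub>E i\<in>UNIV. UNIV). \<forall>i\<in>J. f i \<in> A i} | A J. J \<in> {J :: 'i set. finite J} \<and> A \<in> Pi J (\<lambda>_. range atMost :: 'c set set)}"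
  have "sets (Pi\<^sub>M UNIV (\<lambda>_::'i. sigma UNIV (range atMost :: 'c set set))) = sets (sigma (\<Pi>\<^sub>E i\<in>UNIV. UNIV) P)"
    unfolding P_def
  proof (rule sets_PiM_sigma)
    have "\<exists>n::nat. x \<le> real n *\<^sub>R One" for x :: 'c
    proof -
      obtain n where n: "norm x \<le> real n" using real_arch_simple by blast
      have "x \<bullet> i \<le> real n" if "i \<in> Basis" for i
        using Basis_le_norm[OF that, of x] n by linarith
      then show ?thesis by (auto simp: eucl_le[where 'a='c])
    qed
    then show "\<exists>S\<subseteq>range (atMost :: 'c \<Rightarrow> _). countable S \<and> UNIV = \<Union>S"
      by (intro exI[of _ "range (\<lambda>n::nat. {.. real n *\<^sub>R One})"]) auto
  qed auto
  then have gen: "sets (Pi\<^sub>M UNIV (\<lambda>_::'i. borel :: 'c measure)) = sigma_sets UNIV P"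
    by (subst (asm) sets_measure_of) (auto simp: P_def borel_eq_atMost PiE_UNIV_domain)
  have P_eq: "P = {{f. \<forall>i\<in>J. f i \<le> z i} | z J. finite J}" (is "_ = ?Q")
  proof
    show "P \<subseteq> ?Q"
    proof
      fix B assume "B \<in> P"
      then obtain A J where B: "B = {f. \<forall>i\<in>J. f i \<in> A i}" "finite J" "\<forall>i\<in>J. \<exists>z. A i = {..z}"
        by (auto simp: P_def PiE_UNIV_domain Pi_iff image_iff)
      then obtain z where "\<forall>i\<in>J. A i = {..z i}" by metis
      with B show "B \<in> ?Q" by auto
    qed
    show "?Q \<subseteq> P"
    proof safe
      fix z :: "'i \<Rightarrow> 'c" and J :: "'i set" assume "finite J"
      then show "{f. \<forall>i\<in>J. f i \<le> z i} \<in> P"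
        by (auto simp: P_def PiE_UNIV_domain intro!: exI[of _ "\<lambda>i. {..z i}"] exI[of _ J])
    qed
  qed
  show ?thesis
  proof (rule measure_eqI_generator_eq[where E = P and \<Omega> = UNIV and A = "\<lambda>_. UNIV"])
    show "Int_stable P"
    proof (rule Int_stableI)
      fix a b assume "a \<in> P" "b \<in> P"
      then obtain z J z' J' where "a = {f. \<forall>i\<in>J. f i \<le> z i}" "finite J"
        "b = {f. \<forall>i\<in>J'. f i \<le> z' i}" "finite J'"
        unfolding P_eq by blast
      then show "a \<inter> b \<in> P"
        unfolding P_eq
        by (auto intro!: exI[of _ "\<lambda>i. if i \<in> J \<and> i \<in> J' then inf (z i) (z' i) else if i \<in> J then z i else z' i"]
              exI[of _ "J \<union> J'"] split: if_splits)
    qed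
    show "range (\<lambda>_. UNIV) \<subseteq> P" unfolding P_eq by auto
    show "emeasure \<mu> X = emeasure \<nu> X" if "X \<in> P" for X
      using that eq unfolding P_eq by auto
  qed (use sets gen fin in auto)
qed

section \<open>The radial measure and its power tail\<close>

definition ray :: "real \<Rightarrow> real measure" where
  "ray \<alpha> = density (restrict_space lborel {0<..}) (\<lambda>u. ennreal (\<alpha> * u powr (- \<alpha> - 1)))"

lemma space_ray [simp]: "space (ray \<alpha>) = {0<..}"
  by (simp add: ray_def space_restrict_space)

lemma sets_ray [measurable_cong]: "sets (ray \<alpha>) = sets (restrict_space borel {0<..})"
  by (simp add: ray_def sets_restrict_space)

lemma emeasure_ray:
  assumes "\<alpha> > 0" "y > 0"
  shows "emeasure (ray \<alpha>) {u. u > y} = ennreal (y powr (-\<alpha>))"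
proof -
  have [measurable]: "{y<..} \<in> sets borel" by simp
  have s: "{u. u > y} \<in> sets (restrict_space lborel {0<..})"
    using \<open>y > 0\<close> by (auto simp: sets_restrict_space_iff)
  have "emeasure (ray \<alpha>) {u. u > y} =
    (\<integral>\<^sup>+u. ennreal (\<alpha> * u powr (- \<alpha> - 1)) * indicator {u. u > y} u \<partial>restrict_space lborel {0<..})"
    unfolding ray_def using s by (subst emeasure_density) (auto intro!: measurable_restrict_space1)
  also have "\<dots> = (\<integral>\<^sup>+u. ennreal (\<alpha> * u powr (- \<alpha> - 1)) * indicator {u. u > y} u * indicator {0<..} u \<partial>lborel)"
    by (subst nn_integral_restrict_space) auto
  \<comment> \<open>Passing to the closed half-line costs only the null set of the endpoint and fits
    the fundamental theorem of calculus on half-lines.\<close>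
  also have "\<dots> = (\<integral>\<^sup>+u. ennreal (\<alpha> * u powr (- \<alpha> - 1)) * indicator {y..} u \<partial>lborel)"
    using \<open>y > 0\<close> AE_lborel_singleton[of y]
    by (intro nn_integral_cong_AE) (auto elim!: eventually_mono split: split_indicator)
  also have "\<dots> = ennreal (0 - (- (y powr (-\<alpha>))))"
  proof (rule nn_integral_FTC_atLeast)
    show "((\<lambda>u. - (u powr - \<alpha>)) has_real_derivative \<alpha> * u powr (- \<alpha> - 1)) (at u)" if "y \<le> u" for u
      using that assms by (auto intro!: derivative_eq_intros simp: powr_diff field_simps)
    have "((\<lambda>u. - (u powr - \<alpha>)) \<longlongrightarrow> - 0) at_top"
      using assms by (intro tendsto_minus tendsto_neg_powr filterlim_ident) auto
    then show "((\<lambda>u. - (u powr - \<alpha>)) \<longlongrightarrow> 0) at_top" by simp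
  qed (use assms in auto)
  finally show ?thesis by simp
qed

lemma sigma_finite_ray:
  shows "sigma_finite_measure (ray \<alpha>)"
proof -
  interpret sigma_finite_measure "restrict_space lborel {0<..} :: real measure"
    by (rule sigma_finite_measure_restrict_space) (auto intro: lborel.sigma_finite_measure_axioms)
  show ?thesis
    unfolding ray_def
    by (subst sigma_finite_iff_density_finite) (auto intro!: measurable_restrict_space1)
qed

section \<open>Paths, blocks and oscillation of test functions\<close>

abbreviation path_space :: "(int \<Rightarrow> real^'n) measure" where
  "path_space \<equiv> (\<Pi>\<^sub>M t\<in>UNIV. borel)"

text \<open>The index set is countable and the factors are second countable, so the product
  sigma-algebra is the Borel sigma-algebra of the product topology.\<close>

lemma continuous_imp_measurable_path:
  fixes f :: "(int \<Rightarrow> real^'n) \<Rightarrow> 'b::topological_space"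
  shows "continuous_on UNIV f \<Longrightarrow> f \<in> borel_measurable path_space"
  using borel_measurable_continuous_onI[of f] measurable_cong_sets[OF sets_PiM_equal_borel refl] by blast

text \<open>Blocks are extensional functions and hence already paths: each coordinate outside
  \<open>{s..t}\<close> is the constant \<open>undefined\<close>. Together with
  \<open>continuous_map_restrict\<close> this carries test functions back and forth between blocks
  and paths.\<close>

lemma continuous_map_block_id:
  "continuous_map (block_topology s t) euclidean (\<lambda>x :: int \<Rightarrow> real^'n. x)"
proof -
  have "continuous_map (block_topology s t) euclidean (\<lambda>x :: int \<Rightarrow> real^'n. x k)" for k
  proof (cases "k \<in> {s..t}")
    case True
    then show ?thesis
      unfolding block_topology_def by (rule continuous_map_product_projection)
  next
    case False
    then have eq: "undefined = x k" if "x \<in> topspace (block_topology s t)" for x :: "int \<Rightarrow> real^'n"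
      using that PiE_arb[of x "{s..t}" "\<lambda>_. UNIV" k] by (simp add: block_topology_def)
    have "continuous_map (block_topology s t) euclidean (\<lambda>x :: int \<Rightarrow> real^'n. undefined :: real^'n)"
      by simp
    then show ?thesis
      by (rule continuous_map_eq) (rule eq)
  qed
  then show ?thesis
    unfolding euclidean_product_topology[symmetric] continuous_map_componentwise_UNIV by blast
qed

lemma continuous_map_restrict:
  "continuous_map euclidean (block_topology s t) (\<lambda>x :: int \<Rightarrow> real^'n. restrict x {s..t})"
  unfolding block_topology_def continuous_map_componentwise by auto

lemma measurable_block_id: "(\<lambda>x :: int \<Rightarrow> real^'n. x) \<in> block_space s t \<rightarrow>\<^sub>M path_space"
proof (rule measurable_PiM_single')
  fix k :: int
  show "(\<lambda>x :: int \<Rightarrow> real^'n. x k) \<in> borel_measurable (block_space s t)"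
  proof (cases "k \<in> {s..t}")
    case True
    then show ?thesis
      unfolding block_space_def by (rule measurable_component_singleton)
  next
    case False
    then have eq: "x k = undefined" if "x \<in> space (block_space s t)" for x :: "int \<Rightarrow> real^'n"
      using that PiE_arb[of x "{s..t}" "\<lambda>_. UNIV" k] by (simp add: block_space_def space_PiM)
    have "(\<lambda>x :: int \<Rightarrow> real^'n. x k) \<in> borel_measurable (block_space s t) \<longleftrightarrow>
      (\<lambda>_ :: int \<Rightarrow> real^'n. undefined :: real^'n) \<in> borel_measurable (block_space s t)"
      by (rule measurable_cong) (rule eq)
    then show ?thesis by simp
  qed
qed auto

lemma nn_integral_count_space_int:
  "(\<integral>\<^sup>+k. f k \<partial>count_space (UNIV :: int set)) = (\<Sum>n. f (int_decode n))"
  using nn_integral_bij_count_space[of int_decode UNIV UNIV f] bij_int_decode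
  by (simp add: nn_integral_count_space_nat)

text \<open>This covers divergent sums too: \<open>infsum\<close> is then 0 by convention, and
  \<open>enn2real\<close> sends infinity to 0.\<close>

lemma infsum_eq_enn2real:
  assumes "\<And>x. 0 \<le> f x"
  shows "infsum f A = enn2real (\<integral>\<^sup>+x. ennreal (f x) \<partial>count_space A)"
proof (cases "f summable_on A")
  case True
  then have s: "Infinite_Set_Sum.abs_summable_on f A"
    unfolding abs_summable_equivalent[symmetric] by (rule summable_on_iff_abs_summable_on_real[THEN iffD1])
  then have "infsum f A = infsetsum f A" by (simp add: infsetsum_infsum)
  then show ?thesis
    by (simp add: infsetsum_def integral_eq_nn_integral assms)
next
  case False
  then have "\<not> integrable (count_space A) f"
    using assms abs_summable_on_def abs_summable_equivalent[of f A] summable_on_iff_abs_summable_on_real[of f A] by metis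
  then have "(\<integral>x. f x \<partial>count_space A) = 0" by (rule not_integrable_integral_eq)
  with False show ?thesis
    by (simp add: infsum_not_exists integral_eq_nn_integral assms)
qed

lemma emeasure_Collect_measurable:
  assumes "f \<in> N \<rightarrow>\<^sub>M K" "A \<in> sets K"
  shows "emeasure N {x \<in> space N. f x \<in> A} = (\<integral>\<^sup>+x. indicator A (f x) \<partial>N)"
proof -
  have "{x \<in> space N. f x \<in> A} \<in> sets N" by (rule Collect_vimage_sets[OF assms])
  then have "emeasure N {x \<in> space N. f x \<in> A} = integral\<^sup>N N (indicator {x \<in> space N. f x \<in> A})"
    by simp
  also have "\<dots> = (\<integral>\<^sup>+x. indicator A (f x) \<partial>N)"
    by (intro nn_integral_cong) (auto split: split_indicator)
  finally show ?thesis .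
qed

text \<open>A substitute for a modulus of uniform continuity: the paths at which \<open>f\<close>
  oscillates by more than \<eta> at scale \<open>e\<close>. The tolerance grows with
  \<open>norm (y j)\<close> because dividing by a perturbed norm produces an error proportional to
  the path.\<close>

definition unstable :: "int set \<Rightarrow> ((int \<Rightarrow> real^'n) \<Rightarrow> real) \<Rightarrow> real \<Rightarrow> real \<Rightarrow> (int \<Rightarrow> real^'n) set" where
  "unstable F f e \<eta> = {y. \<exists>z. (\<forall>j\<in>F. dist (z j) (y j) < e * (1 + norm (y j))) \<and> \<bar>f z - f y\<bar> > \<eta>}"

lemma unstable_mono:
  assumes "e \<le> e'"
  shows "unstable F f e \<eta> \<subseteq> unstable F f e' \<eta>"
proof
  fix y assume "y \<in> unstable F f e \<eta>"
  then obtain z where z: "\<And>j. j \<in> F \<Longrightarrow> dist (z j) (y j) < e * (1 + norm (y j))" and far: "\<bar>f z - f y\<bar> > \<eta>"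
    unfolding unstable_def by blast
  have "dist (z j) (y j) < e' * (1 + norm (y j))" if "j \<in> F" for j
  proof -
    have "e * (1 + norm (y j)) \<le> e' * (1 + norm (y j))"
      using assms by (intro mult_right_mono add_nonneg_nonneg) auto
    with z[OF that] show ?thesis by linarith
  qed
  with far show "y \<in> unstable F f e' \<eta>" unfolding unstable_def by blast
qed

text \<open>The quantifier over \<open>z\<close> is uncountable, but for fixed \<open>z\<close> the
  conditions on \<open>y\<close> are strict inequalities between continuous functions, so the union
  is open.\<close>

lemma unstable_sets:
  assumes F: "finite F" and f: "continuous_on UNIV f"
  shows "unstable F f e \<eta> \<in> sets path_space"
proof -
  have "unstable F f e \<eta> = (\<Union>z. (\<Inter>j\<in>F. {y. dist (z j) (y j) < e * (1 + norm (y j))}) \<inter> {y. \<eta> < \<bar>f z - f y\<bar>})"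
    by (auto simp: unstable_def)
  also have "open \<dots>"
    using F by (intro open_UN open_Int open_INT ballI open_Collect_less continuous_intros f
        continuous_on_product_coordinates)
  finally have "unstable F f e \<eta> \<in> sets borel" by simp
  then show ?thesis using sets_PiM_equal_borel by blast
qed

text \<open>A path in all these sets would be a limit, on \<open>F\<close>, of paths whose values
  under \<open>f\<close> stay \<eta> away, against continuity. Hence the probability of
  \<open>unstable\<close> tends to 0 with the scale.\<close>

lemma unstable_Inter:
  assumes f: "continuous_on UNIV f" and \<eta>: "\<eta> > 0"
    and dep: "\<And>x y. (\<And>j. j \<in> F \<Longrightarrow> x j = y j) \<Longrightarrow> f x = f y"
  shows "(\<Inter>n. unstable F f (1 / real (Suc n)) \<eta>) = {}"
proof (rule ccontr)
  assume "(\<Inter>n. unstable F f (1 / real (Suc n)) \<eta>) \<noteq> {}"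
  then obtain y where "\<forall>n. y \<in> unstable F f (1 / real (Suc n)) \<eta>" by auto
  then have "\<forall>n. \<exists>z. (\<forall>j\<in>F. dist (z j) (y j) < 1 / real (Suc n) * (1 + norm (y j))) \<and> \<bar>f z - f y\<bar> > \<eta>"
    unfolding unstable_def by blast
  then obtain z where z: "\<And>n j. j \<in> F \<Longrightarrow> dist (z n j) (y j) < 1 / real (Suc n) * (1 + norm (y j))"
    and far: "\<And>n. \<bar>f (z n) - f y\<bar> > \<eta>" by metis
  \<comment> \<open>Off \<open>F\<close> the witnesses are arbitrary; overwritten there by
    \<open>y\<close> they converge in every coordinate, and by \<open>dep\<close> the values of
    \<open>f\<close> do not change.\<close>
  define z' where "z' n j = (if j \<in> F then z n j else y j)" for n j
  have "(\<lambda>n. z' n j) \<longlonglongrightarrow> y j" for j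
  proof (rule metric_tendsto_imp_tendsto)
    have "(\<lambda>n. 1 / real (Suc n) * (1 + norm (y j))) \<longlonglongrightarrow> 0 * (1 + norm (y j))"
      using LIMSEQ_inverse_real_of_nat by (intro tendsto_mult tendsto_const) (simp add: inverse_eq_divide)
    then show "(\<lambda>n. 1 / real (Suc n) * (1 + norm (y j))) \<longlonglongrightarrow> 0" by simp
    show "\<forall>\<^sub>F n in sequentially. dist (z' n j) (y j) \<le> dist (1 / real (Suc n) * (1 + norm (y j))) 0"
      using z[of j] by (auto simp: z'_def intro!: always_eventually less_imp_le)
  qed
  then have "z' \<longlonglongrightarrow> y"
    unfolding limitin_canonical_iff[symmetric] euclidean_product_topology[symmetric] limitin_componentwise
    by simp
  then have "(\<lambda>n. f (z' n)) \<longlonglongrightarrow> f y"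
    using f by (intro continuous_on_tendsto_compose[OF f]) auto
  moreover have "f (z' n) = f (z n)" for n by (rule dep) (simp add: z'_def)
  ultimately have "\<forall>\<^sub>F n in sequentially. dist (f (z n)) (f y) < \<eta>"
    using \<eta> by (auto dest: tendstoD)
  then obtain n where "dist (f (z n)) (f y) < \<eta>" by (auto simp: eventually_sequentially)
  with far[of n] show False by (simp add: dist_real_def)
qed

section \<open>The time change formula on the path space and the intensity\<close>

locale tcf_process =
  fixes nrm :: "real^'n \<Rightarrow> real" and \<alpha> :: real
    and M :: "'a measure" and \<Theta> :: "int \<Rightarrow> 'a \<Rightarrow> real^'n"
  assumes nrm: "norm_on_Rd nrm" and alpha: "\<alpha> > 0"
    and nonneg: "\<And>t. \<Theta> t \<in> M \<rightarrow>\<^sub>M nonneg_borel"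
    and SC: "property_SC nrm \<alpha> M \<Theta>"
    and TCF: "property_TCF nrm \<alpha> M \<Theta>"
begin

sublocale prob_space M
  using TCF by (auto simp: property_TCF_def time_series_def)

lemma measurable_nrm [measurable]: "nrm \<in> borel_measurable borel"
  by (intro borel_measurable_continuous_onI norm_on_Rd_continuous nrm)

lemma measurable_Theta [measurable]: "\<Theta> t \<in> borel_measurable M"
  using TCF by (auto simp: property_TCF_def time_series_def)

lemma nrm_nonneg [simp]: "0 \<le> nrm x"
  using nrm by (simp add: norm_on_Rd_def)

lemma nrm_eq_0 [simp]: "nrm x = 0 \<longleftrightarrow> x = 0"
  using nrm by (simp add: norm_on_Rd_def)

lemma nrm_0 [simp]: "nrm 0 = 0"
  by simp

lemma nrm_pos [simp]: "0 < nrm x \<longleftrightarrow> x \<noteq> 0"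
  using nrm_nonneg[of x] nrm_eq_0[of x] by linarith

lemma nrm_scaleR [simp]: "nrm (c *\<^sub>R x) = \<bar>c\<bar> * nrm x"
  using nrm by (simp add: norm_on_Rd_def)

lemma AE_nrm_Theta_0: "AE \<omega> in M. nrm (\<Theta> 0 \<omega>) = 1"
  using TCF by (auto simp: property_TCF_def)

text \<open>(TCF) admits only functions vanishing at \<theta> with \<open>\<theta> 0 = 0\<close>, so
  \<open>H\<close> is cut off by \<open>min 1 (real m * nrm (x 0))\<close> and m is sent to infinity
  by monotone convergence. In the limit the cutoff is the indicator of
  \<open>x 0 \<noteq> 0\<close>: on the left a condition on \<open>\<Theta> (- i)\<close>, on the
  right almost sure wherever the weight is positive.\<close>

lemma TCF_block:
  assumes cont: "continuous_on UNIV H" and H: "\<And>x. 0 \<le> H x" "\<And>x. H x \<le> 1"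
    and dep: "\<And>x. H (restrict x {s..t}) = H x" and st: "s \<le> 0" "0 \<le> t"
  shows "(\<integral>\<^sup>+\<omega>. ennreal (H (\<lambda>j. \<Theta> (j - i) \<omega>)) * indicator {\<omega>. \<Theta> (- i) \<omega> \<noteq> 0} \<omega> \<partial>M) =
    (\<integral>\<^sup>+\<omega>. ennreal (H (\<lambda>j. \<Theta> j \<omega> /\<^sub>R nrm (\<Theta> i \<omega>))) * ennreal (nrm (\<Theta> i \<omega>) powr \<alpha>) \<partial>M)"
proof -
  have [measurable]: "H \<in> borel_measurable path_space"
    by (rule continuous_imp_measurable_path) fact
  have [measurable]: "(\<lambda>\<omega> j. \<Theta> (j - i) \<omega>) \<in> M \<rightarrow>\<^sub>M path_space"
    "(\<lambda>\<omega> j. \<Theta> j \<omega> /\<^sub>R nrm (\<Theta> i \<omega>)) \<in> M \<rightarrow>\<^sub>M path_space"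
    by (auto intro!: measurable_PiM_single')
  define G where "G m x = H x * min 1 (real m * nrm (x 0))" for m x
  have G: "0 \<le> G m x" "G m x \<le> 1" for m x
    unfolding G_def using H[of x] by (auto intro!: mult_le_one)
  have G_dep: "G m (restrict x {s..t}) = G m x" for m x
    using st by (simp add: G_def dep)
  have G_cont: "continuous_on UNIV (G m)" for m
    unfolding G_def
    by (intro continuous_intros cont continuous_on_min
        continuous_on_compose2[OF norm_on_Rd_continuous[OF nrm]] continuous_on_product_coordinates) auto
  have [measurable]: "G m \<in> borel_measurable path_space" for m
    by (rule continuous_imp_measurable_path) fact
  have eq: "(\<integral>\<^sup>+\<omega>. ennreal (G m (\<lambda>j. \<Theta> (j - i) \<omega>)) \<partial>M) =
    (\<integral>\<^sup>+\<omega>. ennreal (G m (\<lambda>j. \<Theta> j \<omega> /\<^sub>R nrm (\<Theta> i \<omega>))) * ennreal (nrm (\<Theta> i \<omega>) powr \<alpha>) \<partial>M)" for m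
  proof -
    let ?g = "\<lambda>\<omega>. G m (\<lambda>j\<in>{s..t}. \<Theta> j \<omega> /\<^sub>R nrm (\<Theta> i \<omega>)) * indicator {\<omega>. nrm (\<Theta> i \<omega>) > 0} \<omega> * nrm (\<Theta> i \<omega>) powr \<alpha>"
    have "continuous_map (block_topology s t) euclideanreal (G m \<circ> (\<lambda>x. x))"
      using G_cont by (intro continuous_map_compose[OF continuous_map_block_id]) auto
    moreover have "bounded (G m ` topspace (block_topology s t))"
      using G by (intro boundedI[where B = 1]) auto
    ultimately have "bounded_continuous_map (block_topology s t) (G m)"
      by (auto simp: bounded_continuous_map_def comp_def)
    moreover have "\<forall>\<theta>\<in>topspace (block_topology s t). \<theta> 0 = 0 \<longrightarrow> G m \<theta> = 0"
      by (auto simp: G_def)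
    ultimately have int: "integrable M ?g"
      and eq: "(\<integral>\<omega>. G m (\<lambda>j\<in>{s..t}. \<Theta> (j - i) \<omega>) \<partial>M) = integral\<^sup>L M ?g"
      using TCF st unfolding property_TCF_def Let_def by blast+
    \<comment> \<open>The indicator is accounted for by \<open>0 powr \<alpha> = 0\<close>.\<close>
    have g: "?g \<omega> = G m (\<lambda>j. \<Theta> j \<omega> /\<^sub>R nrm (\<Theta> i \<omega>)) * nrm (\<Theta> i \<omega>) powr \<alpha>" for \<omega>
      using G_dep[of m "\<lambda>j. \<Theta> j \<omega> /\<^sub>R nrm (\<Theta> i \<omega>)"] by (auto simp: indicator_def)
    have "(\<integral>\<^sup>+\<omega>. ennreal (G m (\<lambda>j. \<Theta> (j - i) \<omega>)) \<partial>M) = ennreal (\<integral>\<omega>. G m (\<lambda>j. \<Theta> (j - i) \<omega>) \<partial>M)"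
      using G by (intro nn_integral_eq_integral integrable_const_bound[where B = 1]) auto
    also have "\<dots> = ennreal (integral\<^sup>L M ?g)"
      using eq G_dep[of m "\<lambda>j. \<Theta> (j - i) _"] by simp
    also have "\<dots> = (\<integral>\<^sup>+\<omega>. ennreal (?g \<omega>) \<partial>M)"
      using G by (intro nn_integral_eq_integral[symmetric] int) auto
    finally show ?thesis
      unfolding g using G by (simp add: ennreal_mult)
  qed
  have lim: "(\<lambda>m. min 1 (real m * nrm y)) \<longlonglongrightarrow> indicator {y. y \<noteq> 0} y" for y
  proof (cases "y = 0")
    case False
    obtain m0 where m0: "real m0 * nrm y > 1" using reals_Archimedean3[of "nrm y"] False by auto
    have "1 \<le> real m * nrm y" if "m \<ge> m0" for m
      using m0 mult_right_mono[of "real m0" "real m" "nrm y"] that by simp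
    then show ?thesis using False
      by (intro tendsto_eventually) (auto intro!: eventually_sequentiallyI[of m0])
  qed auto
  have G_lim: "(\<lambda>m. ennreal (G m x)) \<longlonglongrightarrow> ennreal (H x) * indicator {x. x 0 \<noteq> 0} x" for x
  proof -
    have "(\<lambda>m. ennreal (G m x)) \<longlonglongrightarrow> ennreal (H x * indicator {x. x 0 \<noteq> 0} x)"
      unfolding G_def using lim[of "x 0"]
      by (intro tendsto_intros) (auto simp: indicator_def)
    then show ?thesis by (auto simp: indicator_def split: if_splits)
  qed
  have G_mono: "G m x \<le> G m' x" if "m \<le> m'" for m m' x
    unfolding G_def using that H(1)[of x]
    by (intro mult_left_mono min.mono order_refl mult_right_mono) auto
  have lim1: "(\<lambda>m. \<integral>\<^sup>+\<omega>. ennreal (G m (\<lambda>j. \<Theta> (j - i) \<omega>)) \<partial>M) \<longlonglongrightarrow>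
    (\<integral>\<^sup>+\<omega>. ennreal (H (\<lambda>j. \<Theta> (j - i) \<omega>)) * indicator {\<omega>. \<Theta> (- i) \<omega> \<noteq> 0} \<omega> \<partial>M)"
    using G_lim[of "\<lambda>j. \<Theta> (j - i) _"]
    by (intro nn_integral_LIMSEQ) (auto simp: incseq_def le_fun_def indicator_def intro!: G_mono ennreal_leI)
  have lim2: "(\<lambda>m. \<integral>\<^sup>+\<omega>. ennreal (G m (\<lambda>j. \<Theta> j \<omega> /\<^sub>R nrm (\<Theta> i \<omega>))) * ennreal (nrm (\<Theta> i \<omega>) powr \<alpha>) \<partial>M) \<longlonglongrightarrow>
    (\<integral>\<^sup>+\<omega>. ennreal (H (\<lambda>j. \<Theta> j \<omega> /\<^sub>R nrm (\<Theta> i \<omega>))) * indicator {x. x 0 \<noteq> 0} (\<lambda>j. \<Theta> j \<omega> /\<^sub>R nrm (\<Theta> i \<omega>)) * ennreal (nrm (\<Theta> i \<omega>) powr \<alpha>) \<partial>M)"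
    by (intro nn_integral_LIMSEQ) (auto simp: incseq_def le_fun_def intro!: G_mono ennreal_leI mult_right_mono tendsto_mult_ennreal G_lim tendsto_const)
  \<comment> \<open>Where \<open>\<Theta> i \<omega> = 0\<close> the rescaled path is zero since
    \<open>inverse 0 = 0\<close>, but the weight is zero there as well; elsewhere
    \<open>nrm (\<Theta> 0 \<omega>) = 1\<close> makes its time 0 entry nonzero.\<close>
  have "(\<integral>\<^sup>+\<omega>. ennreal (H (\<lambda>j. \<Theta> j \<omega> /\<^sub>R nrm (\<Theta> i \<omega>))) * indicator {x. x 0 \<noteq> 0} (\<lambda>j. \<Theta> j \<omega> /\<^sub>R nrm (\<Theta> i \<omega>)) * ennreal (nrm (\<Theta> i \<omega>) powr \<alpha>) \<partial>M)
    = (\<integral>\<^sup>+\<omega>. ennreal (H (\<lambda>j. \<Theta> j \<omega> /\<^sub>R nrm (\<Theta> i \<omega>))) * ennreal (nrm (\<Theta> i \<omega>) powr \<alpha>) \<partial>M)"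
    using AE_nrm_Theta_0 by (intro nn_integral_cong_AE) (auto elim!: eventually_mono simp: indicator_def)
  with LIMSEQ_unique[OF lim1 lim2[folded eq]] show ?thesis by simp
qed

text \<open>Block functions determine finite measures on the path space, so (TCF) extends to all
  measurable functionals of the path; the restriction to functionals vanishing at \<open>\<theta>\<^sub>0 = 0\<close> turns
  into the event \<open>\<Theta>\<^sub>-\<^sub>i \<noteq> 0\<close>.\<close>

lemma TCF_path:
  assumes [measurable]: "H \<in> borel_measurable path_space"
  shows "(\<integral>\<^sup>+\<omega>. H (\<lambda>j. \<Theta> (j - i) \<omega>) * indicator {\<omega>. \<Theta> (- i) \<omega> \<noteq> 0} \<omega> \<partial>M) =
    (\<integral>\<^sup>+\<omega>. H (\<lambda>j. \<Theta> j \<omega> /\<^sub>R nrm (\<Theta> i \<omega>)) * ennreal (nrm (\<Theta> i \<omega>) powr \<alpha>) \<partial>M)"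
proof -
  have [measurable]: "(\<lambda>\<omega> j. \<Theta> (j - i) \<omega>) \<in> M \<rightarrow>\<^sub>M path_space"
    "(\<lambda>\<omega> j. \<Theta> j \<omega> /\<^sub>R nrm (\<Theta> i \<omega>)) \<in> M \<rightarrow>\<^sub>M path_space"
    by (auto intro!: measurable_PiM_single')
  define \<nu>1 where "\<nu>1 = distr (density M (indicator {\<omega>. \<Theta> (- i) \<omega> \<noteq> 0})) path_space (\<lambda>\<omega> j. \<Theta> (j - i) \<omega>)"
  define \<nu>2 where "\<nu>2 = distr (density M (\<lambda>\<omega>. ennreal (nrm (\<Theta> i \<omega>) powr \<alpha>))) path_space
    (\<lambda>\<omega> j. \<Theta> j \<omega> /\<^sub>R nrm (\<Theta> i \<omega>))"
  have [measurable]: "Measurable.pred M (\<lambda>\<omega>. \<Theta> (- i) \<omega> \<noteq> 0)" by measurable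
  have ind [measurable]: "(indicator {\<omega>. \<Theta> (- i) \<omega> \<noteq> 0} :: _ \<Rightarrow> ennreal) \<in> borel_measurable M"
    by (subst borel_measurable_indicator') auto
  have nu1: "integral\<^sup>N \<nu>1 g = (\<integral>\<^sup>+\<omega>. g (\<lambda>j. \<Theta> (j - i) \<omega>) * indicator {\<omega>. \<Theta> (- i) \<omega> \<noteq> 0} \<omega> \<partial>M)"
    if [measurable]: "g \<in> borel_measurable path_space" for g
    unfolding \<nu>1_def by (subst nn_integral_distr) (auto simp: nn_integral_density mult.commute)
  have nu2: "integral\<^sup>N \<nu>2 g = (\<integral>\<^sup>+\<omega>. g (\<lambda>j. \<Theta> j \<omega> /\<^sub>R nrm (\<Theta> i \<omega>)) * ennreal (nrm (\<Theta> i \<omega>) powr \<alpha>) \<partial>M)"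
    if [measurable]: "g \<in> borel_measurable path_space" for g
    unfolding \<nu>2_def by (subst nn_integral_distr) (auto simp: nn_integral_density mult.commute)
  have sets_nu: "sets \<nu>1 = sets path_space" "sets \<nu>2 = sets path_space"
    by (simp_all add: \<nu>1_def \<nu>2_def)
  note [measurable_cong] = sets_nu
  have spaces: "space \<nu>1 = UNIV" "space \<nu>2 = UNIV"
    by (auto simp: \<nu>1_def \<nu>2_def space_PiM)
  have block: "integral\<^sup>N \<nu>1 (\<lambda>x. ennreal (g x)) = integral\<^sup>N \<nu>2 (\<lambda>x. ennreal (g x))"
    if "continuous_on UNIV g" "\<And>x. 0 \<le> g x" "\<And>x. g x \<le> 1" "\<And>x. g (restrict x {s..t}) = g x" "s \<le> 0" "0 \<le> t" for g s t
    using TCF_block[of g, OF that] continuous_imp_measurable_path[OF that(1)]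
    by (simp add: nu1 nu2)
  have one: "emeasure \<nu>1 UNIV = emeasure \<nu>2 UNIV"
    using block[of "\<lambda>_. 1" 0 0] spaces by (simp flip: space_PiM)
  have "emeasure \<nu>1 UNIV = (\<integral>\<^sup>+\<omega>. indicator {\<omega>. \<Theta> (- i) \<omega> \<noteq> 0} \<omega> \<partial>M)"
    using nu1[of "\<lambda>_. 1"] spaces by simp
  also have "\<dots> \<le> (\<integral>\<^sup>+\<omega>. 1 \<partial>M)" by (intro nn_integral_mono) (auto simp: indicator_def)
  finally have fin1: "emeasure \<nu>1 UNIV \<noteq> \<infinity>"
    by (auto simp: emeasure_space_1 top_unique)
  have "\<nu>1 = \<nu>2"
  proof (rule measure_eqI_PiM_atMost)
    fix J :: "int set" and z :: "int \<Rightarrow> real^'n"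
    assume J: "finite J"
    \<comment> \<open>The total excess over the orthant; the functions \<open>g n\<close> are
      continuous, depend on a block only, and converge to the indicator of
      \<open>D x = 0\<close>.\<close>
    define D where "D x = (\<Sum>j\<in>J. \<Sum>k\<in>UNIV. max 0 (x j $ k - z j $ k))" for x :: "int \<Rightarrow> real^'n"
    define g where "g n x = max 0 (1 - real n * D x)" for n x
    have D0: "0 \<le> D x" for x by (auto simp: D_def intro!: sum_nonneg)
    have D_iff: "D x = 0 \<longleftrightarrow> (\<forall>j\<in>J. x j \<le> z j)" for x
    proof -
      have m: "max 0 (x j $ k - z j $ k) = 0 \<longleftrightarrow> x j $ k \<le> z j $ k" for j k
        by linarith
      show ?thesis
        using J by (simp add: D_def sum_nonneg_eq_0_iff sum_nonneg less_eq_vec_def m)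
    qed
    \<comment> \<open>Time 0 is inserted because the blocks of (TCF) must contain it.\<close>
    define s where "s = Min (insert 0 J)"
    define t where "t = Max (insert 0 J)"
    have st: "s \<le> 0" "0 \<le> t" "J \<subseteq> {s..t}" using J by (auto simp: s_def t_def)
    have g_cont: "continuous_on UNIV (g n)" for n
      unfolding g_def D_def
      by (intro continuous_intros continuous_on_max continuous_on_component continuous_on_product_coordinates)
    have g_dep: "g n (restrict x {s..t}) = g n x" for n x
      using st(3) unfolding g_def D_def by (auto intro!: arg_cong[where f = "\<lambda>y. max 0 (1 - real n * y)"] sum.cong)
    have g01: "0 \<le> g n x" "g n x \<le> 1" for n x using D0[of x] by (auto simp: g_def)
    have g_lim: "(\<lambda>n. ennreal (g n x)) \<longlonglongrightarrow> indicator {x. \<forall>j\<in>J. x j \<le> z j} x" for x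
    proof (cases "D x = 0")
      case True
      then show ?thesis by (auto simp: g_def D_iff[symmetric])
    next
      case False
      with D0[of x] have "D x > 0" by linarith
      then obtain n0 where n0: "real n0 * D x > 1" using reals_Archimedean3 by blast
      have "1 - real n * D x \<le> 0" if "n \<ge> n0" for n
        using n0 mult_right_mono[of "real n0" "real n" "D x"] that D0[of x] by simp
      then have "eventually (\<lambda>n. ennreal (g n x) = 0) sequentially"
        by (intro eventually_sequentiallyI[of n0]) (auto simp: g_def max_absorb1)
      with False show ?thesis
        by (intro tendsto_eventually) (auto simp: D_iff[symmetric])
    qed
    have [measurable]: "g n \<in> borel_measurable path_space" for n
      by (rule continuous_imp_measurable_path) fact
    have box: "{x. \<forall>j\<in>J. x j \<le> z j} \<in> sets path_space"
    proof -
      have "{x. \<forall>j\<in>J. x j \<le> z j} = {x\<in>space path_space. \<forall>j\<in>J. x j \<le> z j}" by (simp add: space_PiM)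
      also have "\<dots> \<in> sets path_space" using J by measurable
      finally show ?thesis .
    qed
    have conv: "(\<lambda>n. integral\<^sup>N \<nu> (\<lambda>x. ennreal (g n x))) \<longlonglongrightarrow> emeasure \<nu> {x. \<forall>j\<in>J. x j \<le> z j}"
      if s: "sets \<nu> = sets path_space" and f: "emeasure \<nu> UNIV \<noteq> \<infinity>" for \<nu>
    proof -
      note [measurable_cong] = s
      have sp: "space \<nu> = UNIV" using sets_eq_imp_space_eq[OF s] by (simp add: space_PiM)
      have "(\<lambda>n. integral\<^sup>N \<nu> (\<lambda>x. ennreal (g n x))) \<longlonglongrightarrow> integral\<^sup>N \<nu> (indicator {x. \<forall>j\<in>J. x j \<le> z j})"
        using f box s sp g01 g_lim
        by (intro nn_integral_dominated_convergence[where w = "\<lambda>_. 1"])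
          (auto simp: less_top[symmetric] intro!: borel_measurable_indicator)
      then show ?thesis using box s by simp
    qed
    show "emeasure \<nu>1 {x. \<forall>j\<in>J. x j \<le> z j} = emeasure \<nu>2 {x. \<forall>j\<in>J. x j \<le> z j}"
      using conv[OF sets_nu(1) fin1] conv[OF sets_nu(2)] fin1
      by (auto simp: one block[OF g_cont g01 g_dep st(1,2)] intro: LIMSEQ_unique)
  qed (use sets_nu fin1 in auto)
  then show ?thesis using nu1[OF assms] nu2[OF assms] by simp
qed

text \<open>The alpha-th power sum with value infinity on divergence instead of a default. The
  enumeration of the integers turns measurability into that of a series.\<close>

definition S :: "(int \<Rightarrow> real^'n) \<Rightarrow> ennreal" where
  "S \<theta> = (\<Sum>n. ennreal (nrm (\<theta> (int_decode n)) powr \<alpha>))"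

lemma S_eq: "S \<theta> = (\<integral>\<^sup>+t. ennreal (nrm (\<theta> t) powr \<alpha>) \<partial>count_space UNIV)"
  by (simp add: S_def nn_integral_count_space_int)

lemma measurable_S [measurable]: "S \<in> borel_measurable path_space"
  unfolding S_def by measurable

lemma S_shift: "S (\<lambda>t. \<theta> (t + k)) = S \<theta>"
  unfolding S_eq
  by (rule nn_integral_bij_count_space[where f = "\<lambda>t. ennreal (nrm (\<theta> t) powr \<alpha>)"])
    (rule bij_betwI[where g = "\<lambda>t. t - k"], auto)

lemma S_scaleR: "S (\<lambda>t. c *\<^sub>R \<theta> t) = ennreal (\<bar>c\<bar> powr \<alpha>) * S \<theta>"
  by (simp add: S_def powr_mult ennreal_mult)

lemma alpha_norm_eq: "alpha_norm nrm \<alpha> \<theta> = enn2real (S \<theta>) powr (1 / \<alpha>)"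
  unfolding alpha_norm_def S_eq by (subst infsum_eq_enn2real) auto

lemma measurable_alpha_norm [measurable]: "alpha_norm nrm \<alpha> \<in> borel_measurable path_space"
  unfolding alpha_norm_eq by measurable

text \<open>Positivity of \<open>enn2real\<close> carries both bounds, since it sends 0 and infinity
  alike to 0.\<close>

lemma AE_S: "AE \<omega> in M. 0 < S (\<lambda>t. \<Theta> t \<omega>) \<and> S (\<lambda>t. \<Theta> t \<omega>) < \<infinity>"
  using SC unfolding property_SC_def
proof eventually_elim
  case (elim \<omega>)
  then have "0 < enn2real (S (\<lambda>t. \<Theta> t \<omega>))"
    using infsum_eq_enn2real[of "\<lambda>t. nrm (\<Theta> t \<omega>) powr \<alpha>" UNIV] unfolding S_eq by simp
  then show ?case
    by (simp add: enn2real_positive_iff)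
qed

section \<open>The intensity measure and the storms it carries\<close>

abbreviation \<mu> where "\<mu> \<equiv> intensity \<alpha> M \<Theta>"

definition Y :: "real \<times> int \<times> (int \<Rightarrow> real^'n) \<Rightarrow> int \<Rightarrow> real^'n" where
  "Y p = storm nrm \<alpha> (fst p) (fst (snd p)) (snd (snd p))"

text \<open>This is the zero path where \<open>y 0 = 0\<close>; every use carries a threshold or a
  weight that excludes this case.\<close>

definition normed :: "(int \<Rightarrow> real^'n) \<Rightarrow> int \<Rightarrow> real^'n" where
  "normed y t = y t /\<^sub>R nrm (y 0)"

lemma intensity_eq: "\<mu> = ray \<alpha> \<Otimes>\<^sub>M (count_space UNIV \<Otimes>\<^sub>M path_law M \<Theta>)"
  by (simp add: intensity_def ray_def)

lemma measurable_Theta_path: "(\<lambda>\<omega> t. \<Theta> t \<omega>) \<in> M \<rightarrow>\<^sub>M (\<Pi>\<^sub>M t\<in>UNIV. nonneg_borel)"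
  using nonneg by (intro measurable_PiM_single') (auto simp: measurable_def)

lemma measurable_Theta_path' [measurable]: "(\<lambda>\<omega> t. \<Theta> t \<omega>) \<in> M \<rightarrow>\<^sub>M path_space"
  by (intro measurable_PiM_single') auto

lemma space_nonneg_borel: "space nonneg_borel = {x. \<forall>j. 0 \<le> x $ j}"
  by (simp add: nonneg_borel_def space_restrict_space)

lemma measurable_nonneg_borel: "(\<lambda>x. x) \<in> nonneg_borel \<rightarrow>\<^sub>M borel"
  unfolding nonneg_borel_def by (rule measurable_restrict_space1) auto

lemma space_path_law: "space (path_law M \<Theta>) = UNIV \<rightarrow>\<^sub>E {x. \<forall>j. 0 \<le> x $ j}"
  by (simp add: path_law_def space_PiM space_nonneg_borel)

lemma sets_path_law: "sets (path_law M \<Theta>) = sets (\<Pi>\<^sub>M t\<in>UNIV. nonneg_borel)"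
  by (simp add: path_law_def)

lemma measurable_path_law_id [measurable]: "(\<lambda>x. x) \<in> path_law M \<Theta> \<rightarrow>\<^sub>M path_space"
  using measurable_compose[OF measurable_component_singleton[of _ UNIV "\<lambda>_. nonneg_borel"] measurable_nonneg_borel]
  by (subst measurable_cong_sets[OF sets_path_law refl]) (auto intro!: measurable_PiM_single')

lemma prob_space_path_law: "prob_space (path_law M \<Theta>)"
  unfolding path_law_def by (rule prob_space_distr[OF measurable_Theta_path])

text \<open>Tonelli with the u-integral innermost: for a fixed path and shift, an exceedance of the
  storm is a half-line in u, where the radial measure is explicit.\<close>

lemma nn_integral_intensity:
  assumes g [measurable]: "g \<in> borel_measurable \<mu>"
  shows "integral\<^sup>N \<mu> g =
    (\<integral>\<^sup>+k. \<integral>\<^sup>+\<omega>. \<integral>\<^sup>+u. g (u, k, \<lambda>t. \<Theta> t \<omega>) \<partial>ray \<alpha> \<partial>M \<partial>count_space UNIV)"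
proof -
  interpret pl: prob_space "path_law M \<Theta>" by (rule prob_space_path_law)
  interpret ray: sigma_finite_measure "ray \<alpha>" by (rule sigma_finite_ray)
  interpret cs: sigma_finite_measure "count_space (UNIV :: int set)"
    by (rule sigma_finite_measure_count_space)
  interpret kp: pair_sigma_finite "count_space (UNIV :: int set)" "path_law M \<Theta>" ..
  interpret p: pair_sigma_finite "ray \<alpha>" "count_space (UNIV :: int set) \<Otimes>\<^sub>M path_law M \<Theta>"
    by (intro pair_sigma_finite.intro ray.sigma_finite_measure_axioms kp.sigma_finite_measure_axioms
        sigma_finite_pair_measure cs.sigma_finite_measure_axioms pl.sigma_finite_measure_axioms)
  note g' = g[unfolded intensity_eq]
  have inner [measurable]: "(\<lambda>y. \<integral>\<^sup>+u. g (u, y) \<partial>ray \<alpha>) \<in> borel_measurable (count_space UNIV \<Otimes>\<^sub>M path_law M \<Theta>)"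
    using g' by (intro ray.borel_measurable_nn_integral) simp
  have "integral\<^sup>N \<mu> g = (\<integral>\<^sup>+y. \<integral>\<^sup>+u. g (u, y) \<partial>ray \<alpha> \<partial>(count_space UNIV \<Otimes>\<^sub>M path_law M \<Theta>))"
    unfolding intensity_eq using g' by (subst p.nn_integral_snd) simp_all
  also have "\<dots> = (\<integral>\<^sup>+k. \<integral>\<^sup>+\<theta>. \<integral>\<^sup>+u. g (u, k, \<theta>) \<partial>ray \<alpha> \<partial>path_law M \<Theta> \<partial>count_space UNIV)"
    by (subst pl.nn_integral_fst[symmetric]) simp_all
  also have "\<dots> = (\<integral>\<^sup>+k. \<integral>\<^sup>+\<omega>. \<integral>\<^sup>+u. g (u, k, \<lambda>t. \<Theta> t \<omega>) \<partial>ray \<alpha> \<partial>M \<partial>count_space UNIV)"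
  proof (intro nn_integral_cong)
    fix k :: int
    have "(\<lambda>\<theta>. \<integral>\<^sup>+u. g (u, k, \<theta>) \<partial>ray \<alpha>) \<in> borel_measurable (path_law M \<Theta>)"
      using measurable_compose[OF measurable_Pair1' inner, of k] by simp
    then show "(\<integral>\<^sup>+\<theta>. \<integral>\<^sup>+u. g (u, k, \<theta>) \<partial>ray \<alpha> \<partial>path_law M \<Theta>) =
        (\<integral>\<^sup>+\<omega>. \<integral>\<^sup>+u. g (u, k, \<lambda>t. \<Theta> t \<omega>) \<partial>ray \<alpha> \<partial>M)"
      unfolding path_law_def
      by (subst nn_integral_distr[OF measurable_Theta_path]) (simp_all add: measurable_distr_eq1)
  qed
  finally show ?thesis .
qed

lemma measurable_intensity_fst [measurable]: "fst \<in> borel_measurable \<mu>"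
proof -
  have "(\<lambda>u. u) \<in> ray \<alpha> \<rightarrow>\<^sub>M borel"
    using measurable_cong_sets[OF sets_ray refl] measurable_restrict_space1[of "\<lambda>x. x" borel borel] by auto
  from measurable_compose[OF measurable_fst this] show ?thesis
    unfolding intensity_eq by auto
qed

lemma measurable_intensity_time [measurable]: "(\<lambda>p. fst (snd p)) \<in> \<mu> \<rightarrow>\<^sub>M count_space UNIV"
  unfolding intensity_eq by measurable

lemma measurable_intensity_path_law: "(\<lambda>p. snd (snd p)) \<in> \<mu> \<rightarrow>\<^sub>M path_law M \<Theta>"
  unfolding intensity_eq by measurable

lemma measurable_intensity_path [measurable]: "(\<lambda>p. snd (snd p)) \<in> \<mu> \<rightarrow>\<^sub>M path_space"
  using measurable_compose[OF measurable_intensity_path_law measurable_path_law_id] by simp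

lemma measurable_Y [measurable]: "(\<lambda>p. Y p t) \<in> borel_measurable \<mu>"
proof -
  have [measurable]: "(\<lambda>p. alpha_norm nrm \<alpha> (snd (snd p))) \<in> borel_measurable \<mu>"
    by measurable
  have [measurable]: "(\<lambda>p. snd (snd p) k) \<in> borel_measurable \<mu>" for k
    using measurable_compose[OF measurable_intensity_path measurable_component_singleton[of k UNIV "\<lambda>_. borel"]] by simp
  \<comment> \<open>The time index depends on the point but takes countably many values, so
    measurability at each fixed index suffices.\<close>
  have "(\<lambda>p. snd (snd p) (t + fst (snd p))) \<in> borel_measurable \<mu>"
    by (rule measurable_compose_countable[where f = "\<lambda>k p. snd (snd p) (t + k)" and g = "\<lambda>p. fst (snd p)"])
      measurable
  then show ?thesis unfolding Y_def storm_def by measurable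
qed

lemma measurable_Y_path [measurable]: "Y \<in> \<mu> \<rightarrow>\<^sub>M path_space"
  by (rule measurable_PiM_single') auto

lemma measurable_normed [measurable]: "normed \<in> path_space \<rightarrow>\<^sub>M path_space"
  by (rule measurable_PiM_single') (auto simp: normed_def)

text \<open>The path space of the intensity consists of nonnegative paths, so no null set arises.
  Nonnegativity is what lets small storms change the maximum by no more than their own size.\<close>

lemma Y_nonneg: "p \<in> space \<mu> \<Longrightarrow> 0 \<le> Y p t $ j"
  by (auto simp: intensity_eq space_pair_measure space_path_law Y_def storm_def alpha_norm_eq PiE_def Pi_def
      intro!: mult_nonneg_nonneg)

lemma Y_time_shift: "Y (u, k + h, \<theta>) t = Y (u, k, \<theta>) (t + h)"
  by (simp add: Y_def storm_def algebra_simps)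

text \<open>A time shift of the storm is a translation of its integer mark, and counting measure is
  translation invariant.\<close>

lemma emeasure_intensity_shift:
  assumes [measurable]: "A \<in> sets path_space"
  shows "emeasure \<mu> {p \<in> space \<mu>. (\<lambda>t. Y p (t + h)) \<in> A} = emeasure \<mu> {p \<in> space \<mu>. Y p \<in> A}"
proof -
  have [measurable]: "(\<lambda>p t. Y p (t + h)) \<in> \<mu> \<rightarrow>\<^sub>M path_space"
    by (rule measurable_PiM_single') auto
  have 1: "emeasure \<mu> {p \<in> space \<mu>. (\<lambda>t. Y p (t + h)) \<in> A} = (\<integral>\<^sup>+p. indicator A (\<lambda>t. Y p (t + h)) \<partial>\<mu>)"
    by (rule emeasure_Collect_measurable[where K = path_space]; measurable)+
  have 2: "emeasure \<mu> {p \<in> space \<mu>. Y p \<in> A} = (\<integral>\<^sup>+p. indicator A (Y p) \<partial>\<mu>)"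
    by (rule emeasure_Collect_measurable[where K = path_space]; measurable)+
  have m: "(\<lambda>p. indicator A (Y p)) \<in> borel_measurable \<mu>" "(\<lambda>p. indicator A (\<lambda>t. Y p (t + h))) \<in> borel_measurable \<mu>"
    by measurable
  have bij: "bij_betw (\<lambda>k. k + h) UNIV UNIV"
    by (rule bij_betwI[where g = "\<lambda>t. t - h"]) auto
  have shift: "(\<lambda>t. Y (u, k, \<theta>) (t + h)) = Y (u, k + h, \<theta>)" for u k \<theta>
    by (simp add: fun_eq_iff Y_time_shift)
  show ?thesis
    unfolding 1 2 nn_integral_intensity[OF m(1)] nn_integral_intensity[OF m(2)]
    using nn_integral_bij_count_space[OF bij,
        of "\<lambda>k. \<integral>\<^sup>+\<omega>. \<integral>\<^sup>+u. indicator A (Y (u, k, \<lambda>t. \<Theta> t \<omega>)) \<partial>ray \<alpha> \<partial>M"]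
    by (simp add: shift)
qed

text \<open>The path recentred at k and weighted by
  \<open>nrm (\<Theta> k \<omega>) powr \<alpha> / S\<close> is the right-hand side of (TCF) for a
  suitable functional. Its left-hand side carries the path \<Theta> itself with weight
  \<open>nrm (\<Theta> (- k) \<omega>) powr \<alpha> / S\<close>, and these weights sum to 1 over
  k.\<close>

lemma sum_TCF:
  assumes [measurable]: "D \<in> sets path_space"
  shows "(\<integral>\<^sup>+k. \<integral>\<^sup>+\<omega>. indicator D (normed (\<lambda>t. \<Theta> (t + k) \<omega>)) *
      (ennreal (nrm (\<Theta> k \<omega>) powr \<alpha>) / S (\<lambda>t. \<Theta> t \<omega>)) \<partial>M \<partial>count_space UNIV) =
    (\<integral>\<^sup>+\<omega>. indicator D (\<lambda>t. \<Theta> t \<omega>) \<partial>M)"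
proof -
  have [measurable]: "(\<lambda>\<theta> t. \<theta> (t + k)) \<in> path_space \<rightarrow>\<^sub>M path_space" for k :: int
    by (rule measurable_PiM_single') auto
  \<comment> \<open>The quotient is scale invariant: at the path divided by
    \<open>nrm (\<Theta> k \<omega>)\<close> it is \<open>1 / S\<close>, as
    \<open>nrm (\<Theta> 0 \<omega>) = 1\<close> almost surely. The shift by k in the first factor
    undoes the shift in (TCF).\<close>
  define H where "H k \<theta> = indicator D (\<lambda>t. \<theta> (t + k)) * (ennreal (nrm (\<theta> 0) powr \<alpha>) / S \<theta>)" for k \<theta>
  have [measurable]: "H k \<in> borel_measurable path_space" for k
    unfolding H_def by measurable
  have 1: "(\<integral>\<^sup>+\<omega>. indicator D (normed (\<lambda>t. \<Theta> (t + k) \<omega>)) * (ennreal (nrm (\<Theta> k \<omega>) powr \<alpha>) / S (\<lambda>t. \<Theta> t \<omega>)) \<partial>M) =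
      (\<integral>\<^sup>+\<omega>. H k (\<lambda>j. \<Theta> j \<omega> /\<^sub>R nrm (\<Theta> k \<omega>)) * ennreal (nrm (\<Theta> k \<omega>) powr \<alpha>) \<partial>M)" for k
  proof (rule nn_integral_cong_AE)
    show "AE \<omega> in M. indicator D (normed (\<lambda>t. \<Theta> (t + k) \<omega>)) * (ennreal (nrm (\<Theta> k \<omega>) powr \<alpha>) / S (\<lambda>t. \<Theta> t \<omega>)) =
      H k (\<lambda>j. \<Theta> j \<omega> /\<^sub>R nrm (\<Theta> k \<omega>)) * ennreal (nrm (\<Theta> k \<omega>) powr \<alpha>)"
      using AE_nrm_Theta_0 AE_S
    proof eventually_elim
      case (elim \<omega>)
      define r where "r = nrm (\<Theta> k \<omega>)"
      show ?case
      proof (cases "r = 0")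
        case True
        then show ?thesis by (simp add: r_def)
      next
        case False
        then have r: "r > 0" by (simp add: r_def)
        have "ennreal (nrm (\<Theta> 0 \<omega> /\<^sub>R r) powr \<alpha>) / S (\<lambda>j. \<Theta> j \<omega> /\<^sub>R r) = 1 / S (\<lambda>t. \<Theta> t \<omega>)"
        proof -
          define s where "s = enn2real (S (\<lambda>t. \<Theta> t \<omega>))"
          have s: "S (\<lambda>t. \<Theta> t \<omega>) = ennreal s" "s > 0"
            using elim by (simp_all add: s_def enn2real_positive_iff)
          have "nrm (\<Theta> 0 \<omega> /\<^sub>R r) powr \<alpha> = (1 / r) powr \<alpha>"
            using elim r by (simp add: field_simps)
          moreover have "S (\<lambda>j. \<Theta> j \<omega> /\<^sub>R r) = ennreal ((1 / r) powr \<alpha> * s)"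
            using r s by (simp add: S_scaleR ennreal_mult inverse_eq_divide)
          ultimately have "ennreal (nrm (\<Theta> 0 \<omega> /\<^sub>R r) powr \<alpha>) / S (\<lambda>j. \<Theta> j \<omega> /\<^sub>R r) =
              ennreal ((1 / r) powr \<alpha> / ((1 / r) powr \<alpha> * s))"
            using r s by (simp add: divide_ennreal)
          also have "(1 / r) powr \<alpha> / ((1 / r) powr \<alpha> * s) = 1 / s"
            using r s by simp
          finally show ?thesis using s divide_ennreal[of 1 s] by simp
        qed
        then show ?thesis
          unfolding H_def normed_def r_def[symmetric]
          by (simp add: mult.assoc r_def[symmetric]) (simp add: divide_ennreal_def mult_ac)
      qed
    qed
  qed
  \<comment> \<open>Time 0 of the shifted path is time \<open>- k\<close> of \<Theta>, so the
    numerator vanishes off the event in the indicator.\<close>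
  have 2: "(\<integral>\<^sup>+\<omega>. H k (\<lambda>j. \<Theta> (j - k) \<omega>) * indicator {\<omega>. \<Theta> (- k) \<omega> \<noteq> 0} \<omega> \<partial>M) =
    (\<integral>\<^sup>+\<omega>. indicator D (\<lambda>t. \<Theta> t \<omega>) * (ennreal (nrm (\<Theta> (- k) \<omega>) powr \<alpha>) / S (\<lambda>t. \<Theta> t \<omega>)) \<partial>M)" for k
    using S_shift[of "\<lambda>t. \<Theta> t _" "- k"]
    by (intro nn_integral_cong) (auto simp: H_def indicator_def)
  have "(\<integral>\<^sup>+k. \<integral>\<^sup>+\<omega>. indicator D (normed (\<lambda>t. \<Theta> (t + k) \<omega>)) *
      (ennreal (nrm (\<Theta> k \<omega>) powr \<alpha>) / S (\<lambda>t. \<Theta> t \<omega>)) \<partial>M \<partial>count_space UNIV) =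
    (\<integral>\<^sup>+k. \<integral>\<^sup>+\<omega>. indicator D (\<lambda>t. \<Theta> t \<omega>) * (ennreal (nrm (\<Theta> (- k) \<omega>) powr \<alpha>) / S (\<lambda>t. \<Theta> t \<omega>)) \<partial>M \<partial>count_space UNIV)"
    by (simp add: 1 TCF_path[symmetric] 2)
  also have "\<dots> = (\<integral>\<^sup>+k. \<integral>\<^sup>+\<omega>. indicator D (\<lambda>t. \<Theta> t \<omega>) * (ennreal (nrm (\<Theta> k \<omega>) powr \<alpha>) / S (\<lambda>t. \<Theta> t \<omega>)) \<partial>M \<partial>count_space UNIV)"
    by (rule nn_integral_bij_count_space) (auto intro!: bij_betwI[where g = uminus])
  also have "\<dots> = (\<integral>\<^sup>+\<omega>. (\<Sum>n. indicator D (\<lambda>t. \<Theta> t \<omega>) * (ennreal (nrm (\<Theta> (int_decode n) \<omega>) powr \<alpha>) / S (\<lambda>t. \<Theta> t \<omega>))) \<partial>M)"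
    unfolding nn_integral_count_space_int by (rule nn_integral_suminf[symmetric]) measurable
  also have "\<dots> = (\<integral>\<^sup>+\<omega>. indicator D (\<lambda>t. \<Theta> t \<omega>) \<partial>M)"
  proof (rule nn_integral_cong_AE)
    show "AE \<omega> in M. (\<Sum>n. indicator D (\<lambda>t. \<Theta> t \<omega>) * (ennreal (nrm (\<Theta> (int_decode n) \<omega>) powr \<alpha>) / S (\<lambda>t. \<Theta> t \<omega>))) =
      indicator D (\<lambda>t. \<Theta> t \<omega>)"
      using AE_S
    proof eventually_elim
      case (elim \<omega>)
      have "(\<Sum>n. ennreal (nrm (\<Theta> (int_decode n) \<omega>) powr \<alpha>) / S (\<lambda>t. \<Theta> t \<omega>)) = S (\<lambda>t. \<Theta> t \<omega>) / S (\<lambda>t. \<Theta> t \<omega>)"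
        by (simp add: divide_ennreal_def ennreal_suminf_multc S_def)
      also have "\<dots> = 1" using elim by (intro ennreal_divide_self) auto
      finally show ?case by simp
    qed
  qed
  finally show ?thesis .
qed

text \<open>Normalising removes \<open>u\<close>, so the shape factor leaves the integral; what
  remains is the half-line above \<open>x * a / r\<close>, with a the alpha-norm and r the norm of
  \<open>\<theta> k\<close>.\<close>

lemma emeasure_ray_storm:
  assumes S: "0 < S \<theta>" "S \<theta> < \<infinity>" and x: "x > 0"
  shows "(\<integral>\<^sup>+u. indicator {p. nrm (Y p 0) > x \<and> normed (Y p) \<in> D} (u, k, \<theta>) \<partial>ray \<alpha>) =
    ennreal (x powr (- \<alpha>)) * (indicator D (normed (\<lambda>t. \<theta> (t + k))) * (ennreal (nrm (\<theta> k) powr \<alpha>) / S \<theta>))"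
proof (cases "\<theta> k = 0")
  case True
  then show ?thesis using x alpha by (simp add: Y_def storm_def)
next
  case False
  define a where "a = alpha_norm nrm \<alpha> \<theta>"
  define r where "r = nrm (\<theta> k)"
  have r: "r > 0" using False by (simp add: r_def)
  have Sp: "enn2real (S \<theta>) > 0" using S by (simp add: enn2real_positive_iff)
  then have a: "a > 0" by (simp add: a_def alpha_norm_eq)
  have aS: "a powr \<alpha> = enn2real (S \<theta>)" using alpha Sp by (simp add: a_def alpha_norm_eq powr_powr)
  have normed: "normed (Y (u, k, \<theta>)) = normed (\<lambda>t. \<theta> (t + k))" if "u > 0" for u
    using that a by (auto simp: fun_eq_iff normed_def Y_def storm_def a_def[symmetric] field_simps)
  have big: "nrm (Y (u, k, \<theta>) 0) > x \<longleftrightarrow> u > x * a / r" if "u > 0" for u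
    using that a r by (simp add: Y_def storm_def a_def[symmetric] r_def[symmetric] field_simps)
  have pow: "(x * a / r) powr (- \<alpha>) = x powr (- \<alpha>) * (r powr \<alpha> / enn2real (S \<theta>))"
    using x a r by (simp add: powr_mult powr_divide powr_minus aS field_simps)
  have sets: "{u. u > x * a / r} \<in> sets (ray \<alpha>)"
    using divide_pos_pos[OF mult_pos_pos[OF x a] r] by (auto simp: sets_ray sets_restrict_space_iff)
  have "(\<integral>\<^sup>+u. indicator {p. nrm (Y p 0) > x \<and> normed (Y p) \<in> D} (u, k, \<theta>) \<partial>ray \<alpha>) =
    (\<integral>\<^sup>+u. indicator D (normed (\<lambda>t. \<theta> (t + k))) * indicator {u. u > x * a / r} u \<partial>ray \<alpha>)"
    by (intro nn_integral_cong) (auto simp: normed big split: split_indicator)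
  also have "\<dots> = indicator D (normed (\<lambda>t. \<theta> (t + k))) * ennreal ((x * a / r) powr (- \<alpha>))"
    using sets x a r alpha by (subst nn_integral_cmult_indicator) (auto simp: emeasure_ray)
  also have "ennreal ((x * a / r) powr (- \<alpha>)) = ennreal (x powr (- \<alpha>)) * (ennreal (r powr \<alpha>) / S \<theta>)"
  proof -
    have "S \<theta> = ennreal (enn2real (S \<theta>))" using S by simp
    then show ?thesis unfolding pow using Sp by (metis divide_ennreal ennreal_mult divide_nonneg_pos powr_ge_zero less_imp_le)
  qed
  finally show ?thesis by (simp add: r_def mult.assoc mult.left_commute)
qed

text \<open>The ray integral supplies the power of x and \<open>sum_TCF\<close> the law of the
  shape. Arbitrary measurable \<open>D\<close> are needed, because the exceptional set
  \<open>unstable\<close> will be one of them.\<close>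

lemma emeasure_intensity_normed:
  assumes D: "D \<in> sets path_space" and x: "x > 0"
  shows "emeasure \<mu> {p \<in> space \<mu>. nrm (Y p 0) > x \<and> normed (Y p) \<in> D} =
    ennreal (x powr (- \<alpha>)) * emeasure M {\<omega> \<in> space M. (\<lambda>t. \<Theta> t \<omega>) \<in> D}"
proof -
  note [measurable] = D
  let ?B = "{p. nrm (Y p 0) > x \<and> normed (Y p) \<in> D}"
  have [measurable]: "Measurable.pred \<mu> (\<lambda>p. nrm (Y p 0) > x)" by measurable
  have "(\<lambda>p. normed (Y p)) \<in> \<mu> \<rightarrow>\<^sub>M path_space" by measurable
  from measurable_sets[OF this D] have [measurable]: "Measurable.pred \<mu> (\<lambda>p. normed (Y p) \<in> D)"
    by (simp add: pred_def vimage_def Int_def conj_commute)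
  have B: "{p \<in> space \<mu>. p \<in> ?B} \<in> sets \<mu>" by simp
  have m: "indicator ?B \<in> borel_measurable \<mu>"
    using B by (subst borel_measurable_indicator') (auto simp: Int_def conj_commute)
  have m': "(\<lambda>\<omega>. indicator D (normed (\<lambda>t. \<Theta> (t + k) \<omega>)) * (ennreal (nrm (\<Theta> k \<omega>) powr \<alpha>) / S (\<lambda>t. \<Theta> t \<omega>))) \<in> borel_measurable M" for k
  proof -
    have [measurable]: "(\<lambda>\<omega> t. \<Theta> (t + k) \<omega>) \<in> M \<rightarrow>\<^sub>M path_space"
      by (rule measurable_PiM_single') auto
    show ?thesis by measurable
  qed
  have "emeasure \<mu> {p \<in> space \<mu>. nrm (Y p 0) > x \<and> normed (Y p) \<in> D} = integral\<^sup>N \<mu> (indicator {p \<in> space \<mu>. p \<in> ?B})"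
    using B by (subst nn_integral_indicator) auto
  also have "\<dots> = integral\<^sup>N \<mu> (indicator ?B)"
    by (intro nn_integral_cong) (auto split: split_indicator)
  also have "\<dots> = (\<integral>\<^sup>+k. \<integral>\<^sup>+\<omega>. ennreal (x powr (- \<alpha>)) * (indicator D (normed (\<lambda>t. \<Theta> (t + k) \<omega>)) *
      (ennreal (nrm (\<Theta> k \<omega>) powr \<alpha>) / S (\<lambda>t. \<Theta> t \<omega>))) \<partial>M \<partial>count_space UNIV)"
    unfolding nn_integral_intensity[OF m]
    by (rule nn_integral_cong, rule nn_integral_cong_AE, rule eventually_mono[OF AE_S])
      (simp add: emeasure_ray_storm x)
  also have "\<dots> = ennreal (x powr (- \<alpha>)) * (\<integral>\<^sup>+\<omega>. indicator D (\<lambda>t. \<Theta> t \<omega>) \<partial>M)"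
    by (simp add: nn_integral_cmult m' sum_TCF[OF D])
  also have "(\<integral>\<^sup>+\<omega>. indicator D (\<lambda>t. \<Theta> t \<omega>) \<partial>M) = emeasure M {\<omega> \<in> space M. (\<lambda>t. \<Theta> t \<omega>) \<in> D}"
    by (rule emeasure_Collect_measurable[OF measurable_Theta_path' D, symmetric])
  finally show ?thesis .
qed

text \<open>\<open>D = UNIV\<close> gives the mass at time 0 and shift invariance carries it to time
  t. Its finiteness is what keeps point counts at positive levels finite.\<close>

lemma emeasure_intensity_nrm:
  assumes x: "x > 0"
  shows "emeasure \<mu> {p \<in> space \<mu>. nrm (Y p t) > x} = ennreal (x powr (- \<alpha>))"
proof -
  have D: "{y. nrm (y 0) > x} \<in> sets path_space"
  proof -
    have "{y. nrm (y 0) > x} = {y \<in> space path_space. nrm (y 0) > x}" by (simp add: space_PiM)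
    also have "\<dots> \<in> sets path_space" by measurable
    finally show ?thesis .
  qed
  have "emeasure \<mu> {p \<in> space \<mu>. nrm (Y p t) > x} = emeasure \<mu> {p \<in> space \<mu>. nrm (Y p 0) > x}"
    using emeasure_intensity_shift[OF D, of t] by simp
  also have "\<dots> = ennreal (x powr (- \<alpha>))"
    using emeasure_intensity_normed[of UNIV, OF _ x] sets.top[of path_space]
    by (simp add: space_PiM emeasure_space_1)
  finally show ?thesis .
qed

text \<open>The identity for sets as an equality of image measures, from which integrals of
  measurable functionals follow at once.\<close>

lemma distr_normed:
  assumes x: "x > 0"
  shows "distr (density \<mu> (indicator {p. nrm (Y p 0) > x})) path_space (\<lambda>p. normed (Y p)) =
    distr (density M (\<lambda>_. ennreal (x powr (- \<alpha>)))) path_space (\<lambda>\<omega> t. \<Theta> t \<omega>)"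
proof (rule measure_eqI)
  fix D assume "D \<in> sets (distr (density \<mu> (indicator {p. nrm (Y p 0) > x})) path_space (\<lambda>p. normed (Y p)))"
  then have D: "D \<in> sets path_space" by simp
  have [measurable]: "(\<lambda>p. normed (Y p)) \<in> \<mu> \<rightarrow>\<^sub>M path_space" by measurable
  have "{p \<in> space \<mu>. nrm (Y p 0) > x} \<in> sets \<mu>" by measurable
  then have m [measurable]: "indicator {p. nrm (Y p 0) > x} \<in> borel_measurable \<mu>"
    by (subst borel_measurable_indicator') (auto simp: Int_def conj_commute)
  have "(\<lambda>p. normed (Y p)) \<in> \<mu> \<rightarrow>\<^sub>M path_space" by measurable
  from measurable_sets[OF this D] have s: "{p \<in> space \<mu>. normed (Y p) \<in> D} \<in> sets \<mu>"
    by (simp add: vimage_def Int_def conj_commute)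
  have s1: "{p \<in> space \<mu>. nrm (Y p 0) > x \<and> normed (Y p) \<in> D} \<in> sets \<mu>"
  proof -
    have "{p \<in> space \<mu>. nrm (Y p 0) > x} \<inter> {p \<in> space \<mu>. normed (Y p) \<in> D} \<in> sets \<mu>"
      using s \<open>{p \<in> space \<mu>. nrm (Y p 0) > x} \<in> sets \<mu>\<close> by (intro sets.Int)
    then show ?thesis by (simp add: Int_def conj_ac)
  qed
  have sM: "{\<omega> \<in> space M. (\<lambda>t. \<Theta> t \<omega>) \<in> D} \<in> sets M"
    by (rule Collect_vimage_sets[OF measurable_Theta_path' D])
  have "emeasure (distr (density \<mu> (indicator {p. nrm (Y p 0) > x})) path_space (\<lambda>p. normed (Y p))) D =
    emeasure (density \<mu> (indicator {p. nrm (Y p 0) > x})) {p \<in> space \<mu>. normed (Y p) \<in> D}"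
    using D by (subst emeasure_distr) (auto simp: vimage_def Int_def conj_commute)
  also have "\<dots> = (\<integral>\<^sup>+p. indicator {p \<in> space \<mu>. nrm (Y p 0) > x \<and> normed (Y p) \<in> D} p \<partial>\<mu>)"
    by (subst emeasure_density[OF m s]) (auto intro!: nn_integral_cong split: split_indicator)
  also have "\<dots> = ennreal (x powr (- \<alpha>)) * emeasure M {\<omega> \<in> space M. (\<lambda>t. \<Theta> t \<omega>) \<in> D}"
    using s1 emeasure_intensity_normed[OF D x] by simp
  also have "\<dots> = emeasure (density M (\<lambda>_. ennreal (x powr (- \<alpha>)))) {\<omega> \<in> space M. (\<lambda>t. \<Theta> t \<omega>) \<in> D}"
    using sM by (simp add: emeasure_density nn_integral_cmult_indicator)
  also have "\<dots> = emeasure (distr (density M (\<lambda>_. ennreal (x powr (- \<alpha>)))) path_space (\<lambda>\<omega> t. \<Theta> t \<omega>)) D"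
    using D by (subst emeasure_distr) (auto simp: vimage_def Int_def conj_commute)
  finally show "emeasure (distr (density \<mu> (indicator {p. nrm (Y p 0) > x})) path_space (\<lambda>p. normed (Y p))) D =
    emeasure (distr (density M (\<lambda>_. ennreal (x powr (- \<alpha>)))) path_space (\<lambda>\<omega> t. \<Theta> t \<omega>)) D" .
qed simp

lemma integral_normed:
  fixes f :: "(int \<Rightarrow> real^'n) \<Rightarrow> real"
  assumes f [measurable]: "f \<in> borel_measurable path_space" and x: "x > 0"
  shows "(\<integral>p. indicator {p. nrm (Y p 0) > x} p * f (normed (Y p)) \<partial>\<mu>) = x powr (- \<alpha>) * (\<integral>\<omega>. f (\<lambda>t. \<Theta> t \<omega>) \<partial>M)"
proof -
  have [measurable]: "(\<lambda>p. normed (Y p)) \<in> \<mu> \<rightarrow>\<^sub>M path_space" by measurable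
  have "{p \<in> space \<mu>. nrm (Y p 0) > x} \<in> sets \<mu>" by measurable
  then have m [measurable]: "(indicator {p. nrm (Y p 0) > x} :: _ \<Rightarrow> real) \<in> borel_measurable \<mu>"
    by (subst borel_measurable_indicator') (auto simp: Int_def conj_commute)
  have ind: "(indicator {p. nrm (Y p 0) > x} :: _ \<Rightarrow> ennreal) = (\<lambda>p. ennreal (indicator {p. nrm (Y p 0) > x} p))"
    by (auto simp: fun_eq_iff split: split_indicator)
  have "(\<integral>p. indicator {p. nrm (Y p 0) > x} p * f (normed (Y p)) \<partial>\<mu>) =
    integral\<^sup>L (distr (density \<mu> (indicator {p. nrm (Y p 0) > x})) path_space (\<lambda>p. normed (Y p))) f"
    unfolding ind by (subst integral_distr) (auto simp: integral_density)
  also have "\<dots> = x powr (- \<alpha>) * (\<integral>\<omega>. f (\<lambda>t. \<Theta> t \<omega>) \<partial>M)"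
    unfolding distr_normed[OF x] by (subst integral_distr) (auto simp: integral_density)
  finally show ?thesis .
qed

text \<open>The numerator of the conditional expectation defining the spectral tail process; the
  constant function 1 in place of \<open>f\<close> gives the denominator.\<close>

definition exceed :: "((int \<Rightarrow> real^'n) \<Rightarrow> real) \<Rightarrow> real \<Rightarrow> (int \<Rightarrow> real^'n) \<Rightarrow> real" where
  "exceed f x y = indicator {y. nrm (y 0) > x} y * f (normed y)"

text \<open>Here \<open>y\<close> is the storm and \<open>z\<close> the maximum. Outside the layer
  both or neither exceed x; above it both are normalised and \<open>f\<close> moves by at most
  \<eta> unless \<open>y\<close> is unstable. The error terms depend on \<open>y\<close> alone, so
  they can be integrated against the law of a single storm.\<close>

lemma exceed_stable:
  assumes x: "x > 0" and d: "0 < \<delta>" "\<delta> < 1/2" and c: "c \<ge> 1" "\<And>v. norm v \<le> c * nrm v"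
    and F: "0 \<in> F" and near: "\<And>j. j \<in> F \<Longrightarrow> nrm (z j - y j) \<le> \<delta> * x"
    and C: "\<And>y. \<bar>f y\<bar> \<le> C" and \<eta>: "\<eta> \<ge> 0"
  shows "\<bar>exceed f x z - exceed f x y\<bar> \<le> \<eta> * indicator {y. nrm (y 0) > x} y +
    2 * C * indicator {y. (1 - 2 * \<delta>) * x < nrm (y 0) \<and> nrm (y 0) \<le> (1 + \<delta>) * x} y +
    2 * C * indicator {y. nrm (y 0) > x \<and> normed y \<in> unstable F f (2 * c * \<delta>) \<eta>} y"
proof -
  have C0: "C \<ge> 0" using C[of undefined] by linarith
  have diff: "\<bar>nrm (z 0) - nrm (y 0)\<bar> \<le> \<delta> * x"
    using norm_on_Rd_diff[OF nrm, of "z 0" "y 0"] near[OF F] by linarith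
  have dx: "\<delta> * x > 0" using d x by simp
  consider "nrm (y 0) \<le> (1 - 2 * \<delta>) * x" | "(1 - 2 * \<delta>) * x < nrm (y 0)" "nrm (y 0) \<le> (1 + \<delta>) * x"
    | "(1 + \<delta>) * x < nrm (y 0)" by linarith
  then show ?thesis
  proof cases
    case 1
    then have "nrm (y 0) \<le> x - 2 * (\<delta> * x)" by (simp add: algebra_simps)
    then have "nrm (y 0) < x" "nrm (z 0) < x" using diff dx by linarith+
    then show ?thesis using \<eta> C0 by (simp add: exceed_def)
  next
    case 2
    have "\<bar>exceed f x w\<bar> \<le> C" for w
      using C[of "normed w"] C0 by (simp add: exceed_def indicator_def)
    from this[of z] this[of y] have "\<bar>exceed f x z - exceed f x y\<bar> \<le> 2 * C" by linarith
    moreover have "0 \<le> \<eta> * indicator {y. nrm (y 0) > x} y"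
      "0 \<le> 2 * C * indicator {y. nrm (y 0) > x \<and> normed y \<in> unstable F f (2 * c * \<delta>) \<eta>} y"
      using \<eta> C0 by auto
    moreover have i: "indicator {y. (1 - 2 * \<delta>) * x < nrm (y 0) \<and> nrm (y 0) \<le> (1 + \<delta>) * x} y = (1::real)"
      using 2 by simp
    ultimately show ?thesis unfolding i by linarith
  next
    case 3
    then have "nrm (y 0) > x + \<delta> * x" by (simp add: algebra_simps)
    then have gt: "nrm (y 0) > x" "nrm (z 0) > x" using diff dx by linarith+
    then have eq: "exceed f x z - exceed f x y = f (normed z) - f (normed y)"
      by (simp add: exceed_def)
    have close: "dist (normed z j) (normed y j) < 2 * c * \<delta> * (1 + norm (normed y j))" if j: "j \<in> F" for j
    proof -
      define a b where "a = nrm (y 0)" and "b = nrm (z 0)"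
      have ab: "a > x" "b > x" "a > 0" "b > 0" using gt x by (auto simp: a_def b_def)
      \<comment> \<open>This separates the perturbation of the path from that of the normalising
        constant. The second term scales with \<open>normed y j\<close>, whence the relative
        tolerance in \<open>unstable\<close>.\<close>
      have "normed z j - normed y j = (1 / b) *\<^sub>R (z j - y j) + ((a - b) / b) *\<^sub>R normed y j"
      proof -
        have "(1 / b) *\<^sub>R (z j - y j) + ((a - b) / b) *\<^sub>R ((1 / a) *\<^sub>R y j)
          = (1 / b) *\<^sub>R z j - (1 / b - (a - b) / b * (1 / a)) *\<^sub>R y j"
          by (simp add: scaleR_diff_right scaleR_diff_left)
        also have "1 / b - (a - b) / b * (1 / a) = 1 / a" using ab by (simp add: field_simps)
        finally show ?thesis by (simp add: normed_def a_def b_def inverse_eq_divide)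
      qed
      then have "dist (normed z j) (normed y j) \<le> norm ((1 / b) *\<^sub>R (z j - y j)) + norm (((a - b) / b) *\<^sub>R normed y j)"
        unfolding dist_norm by (simp only: norm_triangle_ineq)
      also have "norm ((1 / b) *\<^sub>R (z j - y j)) \<le> c * \<delta>"
      proof -
        have "norm (z j - y j) \<le> c * (\<delta> * x)"
          using c(2)[of "z j - y j"] mult_left_mono[OF near[OF j], of c] c(1) by linarith
        also have "\<dots> \<le> c * (\<delta> * b)" using ab c(1) d by (intro mult_left_mono) auto
        finally have "norm (z j - y j) / b \<le> c * \<delta>" using ab by (simp add: field_simps)
        then show ?thesis unfolding norm_scaleR using ab by simp
      qed
      also have "norm (((a - b) / b) *\<^sub>R normed y j) \<le> c * \<delta> * norm (normed y j)"
      proof -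
        have "\<bar>a - b\<bar> \<le> \<delta> * x" using diff by (simp add: a_def b_def)
        also have "\<dots> \<le> \<delta> * b" using ab d by (intro mult_left_mono) auto
        also have "\<dots> \<le> c * (\<delta> * b)" using c(1) d ab mult_right_mono[of 1 c "\<delta> * b"] by simp
        finally have "\<bar>a - b\<bar> / b \<le> c * \<delta>" using ab by (simp add: field_simps)
        then have "\<bar>(a - b) / b\<bar> \<le> c * \<delta>" using ab by simp
        then show ?thesis unfolding norm_scaleR by (rule mult_right_mono) simp
      qed
      also have "c * \<delta> + c * \<delta> * norm (normed y j) = c * \<delta> * (1 + norm (normed y j))"
        by (simp add: algebra_simps)
      \<comment> \<open>The factor 2 buys the strict inequality demanded by
        \<open>unstable\<close>.\<close>
      also have "\<dots> < 2 * (c * \<delta> * (1 + norm (normed y j)))"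
      proof -
        have "0 < c * \<delta> * (1 + norm (normed y j))"
          using c(1) d by (intro mult_pos_pos add_pos_nonneg) auto
        then show ?thesis by linarith
      qed
      finally show ?thesis by (simp add: mult.assoc)
    qed
    show ?thesis
    proof (cases "normed y \<in> unstable F f (2 * c * \<delta>) \<eta>")
      case True
      have "\<bar>f (normed z) - f (normed y)\<bar> \<le> 2 * C" using C[of "normed z"] C[of "normed y"] by linarith
      moreover have "0 \<le> 2 * C * indicator {y. (1 - 2 * \<delta>) * x < nrm (y 0) \<and> nrm (y 0) \<le> (1 + \<delta>) * x} y"
        using C0 by auto
      moreover have i: "indicator {y. nrm (y 0) > x} y = (1::real)"
        "indicator {y. nrm (y 0) > x \<and> normed y \<in> unstable F f (2 * c * \<delta>) \<eta>} y = (1::real)"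
        using True gt by simp_all
      ultimately show ?thesis unfolding eq i using \<eta> by linarith
    next
      case False
      then have "\<not> \<bar>f (normed z) - f (normed y)\<bar> > \<eta>"
        using close unfolding unstable_def by blast
      moreover have "0 \<le> 2 * C * indicator {y. (1 - 2 * \<delta>) * x < nrm (y 0) \<and> nrm (y 0) \<le> (1 + \<delta>) * x} y"
        using C0 by auto
      ultimately show ?thesis unfolding eq using False gt by simp
    qed
  qed
qed

end

section \<open>Poisson point processes\<close>

locale poisson_process = prob_space N for N :: "'b measure" +
  fixes \<mu> :: "'e measure" and V :: "nat \<Rightarrow> 'b \<Rightarrow> 'e"
  assumes poisson: "poisson_points N \<mu> V"
begin

lemma measurable_V [measurable]: "V i \<in> N \<rightarrow>\<^sub>M \<mu>"
  using poisson by (simp add: poisson_points_def)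

lemma V_space: "\<omega> \<in> space N \<Longrightarrow> V i \<omega> \<in> space \<mu>"
  using measurable_space[OF measurable_V] .

lemma indep_counts:
  assumes A: "A \<in> sets \<mu>" "B \<in> sets \<mu>" "A \<inter> B = {}"
  shows "indep_vars (\<lambda>_. borel) (\<lambda>n::nat. point_count V (if n = 0 then A else if n = 1 then B else {})) UNIV"
proof -
  have "range (\<lambda>n::nat. if n = 0 then A else if n = 1 then B else {}) \<subseteq> sets \<mu>"
    "disjoint_family (\<lambda>n::nat. if n = 0 then A else if n = 1 then B else {})"
    using A by (auto simp: disjoint_family_on_def)
  with poisson show ?thesis unfolding poisson_points_def by blast
qed

text \<open>Measurability is read off from independence, since \<open>indep_vars\<close> includes it
  for each variable.\<close>

lemma measurable_point_count [measurable]: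
  assumes "A \<in> sets \<mu>"
  shows "point_count V A \<in> borel_measurable N"
proof -
  have "random_variable borel (point_count V (if (0::nat) = 0 then A else if (0::nat) = 1 then {} else {}))"
    using indep_counts[OF assms, of "{}"] unfolding indep_vars_def by blast
  then show ?thesis by simp
qed

lemma prob_two_counts:
  assumes A: "A \<in> sets \<mu>" "B \<in> sets \<mu>" "A \<inter> B = {}"
  shows "\<P>(\<omega> in N. point_count V A \<omega> = a \<and> point_count V B \<omega> = b) =
    \<P>(\<omega> in N. point_count V A \<omega> = a) * \<P>(\<omega> in N. point_count V B \<omega> = b)"
proof -
  let ?X = "\<lambda>n::nat. point_count V (if n = 0 then A else if n = 1 then B else {})"
  let ?S = "\<lambda>n::nat. if n = 0 then {a} else {b}"
  have "prob (\<Inter>n\<in>{0,1}. ?X n -` ?S n \<inter> space N) = (\<Prod>n\<in>{0,1}. prob (?X n -` ?S n \<inter> space N))"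
    by (rule indep_varsD[OF indep_counts[OF A]]) auto
  moreover have "(\<Inter>n\<in>{0,1}. ?X n -` ?S n \<inter> space N) =
    {\<omega> \<in> space N. point_count V A \<omega> = a \<and> point_count V B \<omega> = b}" by auto
  ultimately show ?thesis by (simp add: vimage_def Int_def conj_commute)
qed

lemma prob_count:
  assumes "A \<in> sets \<mu>" "emeasure \<mu> A < \<infinity>"
  shows "\<P>(\<omega> in N. point_count V A \<omega> = of_nat k) = exp (- measure \<mu> A) * measure \<mu> A ^ k / fact k"
  using poisson assms unfolding poisson_points_def by blast

lemma count_eq_0: "point_count V A \<omega> = 0 \<longleftrightarrow> (\<forall>i. V i \<omega> \<notin> A)"
  by (auto simp: point_count_def emeasure_count_space_eq_0)

lemma count_eq_1: "point_count V A \<omega> = 1 \<longleftrightarrow> (\<exists>!i. V i \<omega> \<in> A)"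
proof -
  have "point_count V A \<omega> = 1 \<longleftrightarrow> card {i. V i \<omega> \<in> A} = 1"
    by (cases "finite {i. V i \<omega> \<in> A}") (auto simp: point_count_def emeasure_count_space)
  also have "\<dots> \<longleftrightarrow> (\<exists>!i. V i \<omega> \<in> A)"
    unfolding One_nat_def card_1_singleton_iff set_eq_iff mem_Collect_eq singleton_iff Ex1_def by blast
  finally show ?thesis .
qed

lemma prob_void:
  assumes A: "A \<in> sets \<mu>"
  shows "\<P>(\<omega> in N. \<forall>i. V i \<omega> \<notin> A) = (if emeasure \<mu> A = \<infinity> then 0 else exp (- measure \<mu> A))"
proof (cases "emeasure \<mu> A = \<infinity>")
  case True
  then have "AE \<omega> in N. point_count V A \<omega> = \<infinity>"
    using poisson A unfolding poisson_points_def by blast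
  then have "AE \<omega> in N. \<not> (point_count V A \<omega> = 0)" by eventually_elim simp
  then have "\<P>(\<omega> in N. point_count V A \<omega> = 0) = 0" by (simp add: prob_eq_0_AE)
  with True show ?thesis by (simp add: count_eq_0)
next
  case False
  then show ?thesis using prob_count[of A 0] A by (simp add: less_top count_eq_0)
qed

text \<open>The Poisson weights sum to 1, so the natural numbers exhaust the values of the count up
  to a null set.\<close>

lemma AE_finite_points:
  assumes A: "A \<in> sets \<mu>" "emeasure \<mu> A < \<infinity>"
  shows "AE \<omega> in N. finite {i. V i \<omega> \<in> A}"
proof -
  have [measurable]: "point_count V A \<in> borel_measurable N" using A by simp
  have m: "{\<omega> \<in> space N. point_count V A \<omega> = of_nat k} \<in> sets N" for k :: nat
    by measurable
  have disj: "disjoint_family (\<lambda>k::nat. {\<omega> \<in> space N. point_count V A \<omega> = of_nat k})"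
    by (auto simp: disjoint_family_on_def)
  have "(\<lambda>k. prob {\<omega> \<in> space N. point_count V A \<omega> = of_nat k}) sums
    prob (\<Union>k::nat. {\<omega> \<in> space N. point_count V A \<omega> = of_nat k})"
    using m disj by (intro finite_measure_UNION) auto
  moreover have "(\<lambda>k. prob {\<omega> \<in> space N. point_count V A \<omega> = of_nat k}) sums (exp (- measure \<mu> A) * exp (measure \<mu> A))"
    unfolding prob_count[OF A]
    using sums_mult[OF exp_converges[of "measure \<mu> A"], of "exp (- measure \<mu> A)"]
    by (simp add: field_simps)
  ultimately have "prob (\<Union>k::nat. {\<omega> \<in> space N. point_count V A \<omega> = of_nat k}) = 1"
    by (simp add: sums_unique2 exp_minus)
  then have "AE \<omega> in N. \<omega> \<in> (\<Union>k::nat. {\<omega> \<in> space N. point_count V A \<omega> = of_nat k})"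
    using m by (subst AE_in_set_eq_1) auto
  then show ?thesis
    by eventually_elim (auto simp: point_count_def emeasure_count_space split: if_splits)
qed

text \<open>The least index is a measurable choice of a point. Only values on
  \<open>unique_in B\<close> enter below; without a point in \<open>B\<close> the index is
  arbitrary.\<close>

definition first_in :: "'e set \<Rightarrow> 'b \<Rightarrow> 'e" where
  "first_in B \<omega> = V (LEAST i. V i \<omega> \<in> B) \<omega>"

lemma measurable_first_in [measurable]:
  assumes [measurable]: "B \<in> sets \<mu>"
  shows "first_in B \<in> N \<rightarrow>\<^sub>M \<mu>"
  unfolding first_in_def[abs_def] by measurable

text \<open>Recasts membership as two counts over disjoint sets, to which independence
  applies.\<close>

lemma first_in_mem_iff:
  assumes 1: "\<exists>!i. V i \<omega> \<in> B" and D: "D \<subseteq> B"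
  shows "first_in B \<omega> \<in> D \<longleftrightarrow> (\<exists>!i. V i \<omega> \<in> D) \<and> (\<forall>i. V i \<omega> \<notin> B - D)"
proof -
  obtain i where i: "V i \<omega> \<in> B" "\<And>j. V j \<omega> \<in> B \<Longrightarrow> j = i" using 1 by auto
  have "(LEAST i. V i \<omega> \<in> B) = i"
    by (rule Least_equality) (use i in \<open>blast intro: eq_refl\<close>)+
  then have "first_in B \<omega> = V i \<omega>" by (simp add: first_in_def)
  moreover have "V i \<omega> \<in> D \<Longrightarrow> (\<exists>!i. V i \<omega> \<in> D)" "V i \<omega> \<in> D \<Longrightarrow> \<forall>j. V j \<omega> \<notin> B - D"
    using i D by blast+
  ultimately show ?thesis using i(1) by auto
qed

definition unique_in :: "'e set \<Rightarrow> 'b set" where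
  "unique_in B = {\<omega> \<in> space N. \<exists>!i. V i \<omega> \<in> B}"

lemma unique_in_space: "\<omega> \<in> unique_in B \<Longrightarrow> \<omega> \<in> space N"
  by (simp add: unique_in_def)

lemma first_in_unique:
  assumes "\<omega> \<in> unique_in B"
  shows "first_in B \<omega> \<in> B"
proof -
  have "\<exists>i. V i \<omega> \<in> B" using assms by (auto simp: unique_in_def)
  then show ?thesis unfolding first_in_def by (rule LeastI_ex)
qed

lemma unique_in_sets [measurable]: "B \<in> sets \<mu> \<Longrightarrow> unique_in B \<in> sets N"
  unfolding unique_in_def count_eq_1[symmetric] by measurable

text \<open>Splitting the set \<open>B\<close> into a part containing one point and a part containing none identifies
  the law of a point that is alone in \<open>B\<close>, without any use of the Mecke formula.\<close>

lemma prob_first_in: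
  assumes B: "B \<in> sets \<mu>" "emeasure \<mu> B < \<infinity>" and D: "D \<in> sets \<mu>" "D \<subseteq> B"
  shows "prob {\<omega> \<in> unique_in B. first_in B \<omega> \<in> D} = exp (- measure \<mu> B) * measure \<mu> D"
proof -
  have fin: "emeasure \<mu> D < \<infinity>" "emeasure \<mu> (B - D) < \<infinity>"
    using emeasure_mono[of D B \<mu>] emeasure_mono[of "B - D" B \<mu>] B D by auto
  have sum: "measure \<mu> B = measure \<mu> D + measure \<mu> (B - D)"
    using measure_Union[of \<mu> D "B - D"] fin B D by (simp add: Un_absorb1 less_top[symmetric])
  have eq: "{\<omega> \<in> unique_in B. first_in B \<omega> \<in> D} =
    {\<omega> \<in> space N. point_count V D \<omega> = of_nat 1 \<and> point_count V (B - D) \<omega> = of_nat 0}"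
  proof (intro set_eqI iffI)
    fix \<omega> assume "\<omega> \<in> {\<omega> \<in> unique_in B. first_in B \<omega> \<in> D}"
    then show "\<omega> \<in> {\<omega> \<in> space N. point_count V D \<omega> = of_nat 1 \<and> point_count V (B - D) \<omega> = of_nat 0}"
      using first_in_mem_iff[OF _ D(2), of \<omega>] by (auto simp: unique_in_def count_eq_1 count_eq_0)
  next
    fix \<omega> assume *: "\<omega> \<in> {\<omega> \<in> space N. point_count V D \<omega> = of_nat 1 \<and> point_count V (B - D) \<omega> = of_nat 0}"
    then have **: "\<exists>!i. V i \<omega> \<in> D" "\<forall>i. V i \<omega> \<notin> B - D"
      by (simp_all add: count_eq_1 count_eq_0)
    then have "\<exists>!i. V i \<omega> \<in> B" using D(2) by blast
    with * ** first_in_mem_iff[OF this D(2)] show "\<omega> \<in> {\<omega> \<in> unique_in B. first_in B \<omega> \<in> D}"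
      by (auto simp: unique_in_def)
  qed
  have BD: "B - D \<in> sets \<mu>" using B D by auto
  have e: "exp (- a - b) = exp (- a) * exp (- b)" for a b :: real
    by (simp flip: exp_add)
  show ?thesis
    unfolding eq using prob_two_counts[OF D(1) BD, of "of_nat 1" "of_nat 0"]
      prob_count[OF D(1) fin(1), of 1] prob_count[OF BD fin(2), of 0]
    by (simp add: sum e)
qed

text \<open>The probabilities of \<open>prob_first_in\<close> as an identity of measures: on the
  event of a lone point its law is \<mu> on \<open>B\<close>, damped by the void factor of
  \<open>B\<close>.\<close>

lemma distr_first_in:
  assumes B: "B \<in> sets \<mu>" "emeasure \<mu> B < \<infinity>"
  shows "distr (density N (indicator (unique_in B))) \<mu> (first_in B) =
    density \<mu> (\<lambda>p. ennreal (exp (- measure \<mu> B)) * indicator B p)"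
proof (rule measure_eqI)
  fix D assume "D \<in> sets (distr (density N (indicator (unique_in B))) \<mu> (first_in B))"
  then have D: "D \<in> sets \<mu>" by simp
  note [measurable] = B(1) D
  have fin: "emeasure \<mu> (B \<inter> D) < \<infinity>"
    using emeasure_mono[of "B \<inter> D" B \<mu>] B by auto
  have m: "indicator (unique_in B) \<in> borel_measurable N" and s: "first_in B -` D \<inter> space N \<in> sets N"
    by measurable
  have "emeasure (distr (density N (indicator (unique_in B))) \<mu> (first_in B)) D =
    emeasure (density N (indicator (unique_in B))) (first_in B -` D \<inter> space N)"
    by (subst emeasure_distr) auto
  also have "\<dots> = (\<integral>\<^sup>+\<omega>. indicator (unique_in B \<inter> (first_in B -` D \<inter> space N)) \<omega> \<partial>N)"
    unfolding emeasure_density[OF m s] by (rule nn_integral_cong) (auto split: split_indicator)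
  also have "\<dots> = emeasure N (unique_in B \<inter> (first_in B -` D \<inter> space N))"
    by (rule nn_integral_indicator) auto
  also have "unique_in B \<inter> (first_in B -` D \<inter> space N) = {\<omega> \<in> unique_in B. first_in B \<omega> \<in> B \<inter> D}"
    by (auto dest: first_in_unique unique_in_space)
  also have "emeasure N \<dots> = ennreal (exp (- measure \<mu> B) * measure \<mu> (B \<inter> D))"
    unfolding emeasure_eq_measure using B D by (subst prob_first_in) auto
  also have "\<dots> = ennreal (exp (- measure \<mu> B)) * emeasure \<mu> (B \<inter> D)"
    using fin by (simp add: ennreal_mult emeasure_eq_ennreal_measure less_top[symmetric])
  also have "\<dots> = (\<integral>\<^sup>+p. ennreal (exp (- measure \<mu> B)) * indicator (B \<inter> D) p \<partial>\<mu>)"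
    by (subst nn_integral_cmult_indicator) auto
  also have "\<dots> = emeasure (density \<mu> (\<lambda>p. ennreal (exp (- measure \<mu> B)) * indicator B p)) D"
    by (subst emeasure_density) (auto intro!: nn_integral_cong split: split_indicator)
  finally show "emeasure (distr (density N (indicator (unique_in B))) \<mu> (first_in B)) D =
    emeasure (density \<mu> (\<lambda>p. ennreal (exp (- measure \<mu> B)) * indicator B p)) D" .
qed simp

lemma integral_first_in:
  fixes h :: "'e \<Rightarrow> real"
  assumes B [measurable]: "B \<in> sets \<mu>" and fin: "emeasure \<mu> B < \<infinity>" and h [measurable]: "h \<in> borel_measurable \<mu>"
  shows "(\<integral>\<omega>. indicator (unique_in B) \<omega> * h (first_in B \<omega>) \<partial>N) =
    exp (- measure \<mu> B) * (\<integral>p. indicator B p * h p \<partial>\<mu>)"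
proof -
  have "(\<integral>\<omega>. indicator (unique_in B) \<omega> * h (first_in B \<omega>) \<partial>N) =
    integral\<^sup>L (distr (density N (\<lambda>\<omega>. ennreal (indicator (unique_in B) \<omega>))) \<mu> (first_in B)) h"
    by (subst integral_distr) (auto simp: integral_density)
  also have "\<dots> = integral\<^sup>L (density \<mu> (\<lambda>p. ennreal (exp (- measure \<mu> B) * indicator B p))) h"
    using distr_first_in[OF B fin] by (simp add: ennreal_mult ennreal_indicator)
  also have "\<dots> = exp (- measure \<mu> B) * (\<integral>p. indicator B p * h p \<partial>\<mu>)"
    by (subst integral_density) (auto simp: mult.assoc)
  finally show ?thesis .
qed

text \<open>For error events the factor \<open>exp (- measure \<mu> B)\<close> is bounded by 1, and
  \<open>D\<close> may stick out of \<open>B\<close>.\<close>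

lemma prob_first_in_le:
  assumes B: "B \<in> sets \<mu>" "emeasure \<mu> B < \<infinity>" and D: "D \<in> sets \<mu>" "emeasure \<mu> D < \<infinity>"
  shows "prob {\<omega> \<in> unique_in B. first_in B \<omega> \<in> D} \<le> measure \<mu> D"
proof -
  have "{\<omega> \<in> unique_in B. first_in B \<omega> \<in> D} = {\<omega> \<in> unique_in B. first_in B \<omega> \<in> B \<inter> D}"
    by (auto dest: first_in_unique unique_in_space)
  then have "prob {\<omega> \<in> unique_in B. first_in B \<omega> \<in> D} = exp (- measure \<mu> B) * measure \<mu> (B \<inter> D)"
    using prob_first_in[OF B, of "B \<inter> D"] B D by simp
  also have "\<dots> \<le> 1 * measure \<mu> (B \<inter> D)" by (intro mult_right_mono) auto
  also have "\<dots> \<le> measure \<mu> D"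
    using measure_mono_fmeasurable[of "B \<inter> D" D \<mu>] B D by (auto simp: fmeasurable_def)
  finally show ?thesis .
qed

text \<open>With l the mass of \<open>B\<close>, the probability is
  \<open>1 - exp (- l) * (1 + l)\<close>, and \<open>1 - l \<le> exp (- l)\<close> leaves the square
  of l.\<close>

lemma prob_many_le:
  assumes B: "B \<in> sets \<mu>" "emeasure \<mu> B < \<infinity>"
  shows "prob {\<omega> \<in> space N. (\<exists>i. V i \<omega> \<in> B) \<and> \<omega> \<notin> unique_in B} \<le> (measure \<mu> B)\<^sup>2"
proof -
  note [measurable] = B(1)
  let ?l = "measure \<mu> B"
  let ?Z = "{\<omega> \<in> space N. \<forall>i. V i \<omega> \<notin> B}"
  have Z: "?Z \<in> sets N" unfolding count_eq_0[symmetric] by measurable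
  have U: "unique_in B \<in> sets N" by measurable
  have "{\<omega> \<in> space N. (\<exists>i. V i \<omega> \<in> B) \<and> \<omega> \<notin> unique_in B} = space N - (?Z \<union> unique_in B)" by auto
  then have "prob {\<omega> \<in> space N. (\<exists>i. V i \<omega> \<in> B) \<and> \<omega> \<notin> unique_in B} = 1 - prob (?Z \<union> unique_in B)"
    using Z U by (simp add: prob_compl)
  also have "prob (?Z \<union> unique_in B) = prob ?Z + prob (unique_in B)"
    using Z U by (intro finite_measure_Union) (auto simp: unique_in_def)
  also have "\<dots> = exp (- ?l) * (1 + ?l)"
    using prob_void[OF B(1)] B(2) prob_count[OF B, of 1]
    by (simp add: unique_in_def count_eq_1 algebra_simps)
  also have "1 - exp (- ?l) * (1 + ?l) \<le> 1 - (1 - ?l) * (1 + ?l)"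
    using exp_ge_add_one_self[of "- ?l"] by (intro diff_left_mono mult_right_mono) auto
  finally show ?thesis by (simp add: power2_eq_square algebra_simps)
qed

end

section \<open>Extension of test functions, conditioning and measurable suprema\<close>

lemma continuous_map_block_imp_continuous_on:
  fixes f :: "(int \<Rightarrow> real^'n) \<Rightarrow> real"
  assumes "continuous_map (block_topology s t) euclideanreal f"
  shows "continuous_on UNIV (\<lambda>y. f (restrict y {s..t}))"
  using continuous_map_compose[OF continuous_map_restrict assms] by (simp add: comp_def)

lemma continuous_map_block_imp_measurable:
  fixes f :: "(int \<Rightarrow> real^'n) \<Rightarrow> real"
  assumes "continuous_map (block_topology s t) euclideanreal f"
  shows "f \<in> borel_measurable (block_space s t)"
proof -
  have "(\<lambda>y. f (restrict y {s..t})) \<in> borel_measurable (block_space s t)"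
    using measurable_compose[OF measurable_block_id
        continuous_imp_measurable_path[OF continuous_map_block_imp_continuous_on[OF assms]]] .
  moreover have "f (restrict y {s..t}) = f y" if "y \<in> space (block_space s t)" for y
    using that by (simp add: block_space_def space_PiM PiE_def extensional_restrict)
  ultimately show ?thesis by (subst (asm) measurable_cong) auto
qed

lemma integral_uniform_measure:
  fixes f :: "'a \<Rightarrow> real"
  assumes A: "A \<in> sets M" and f: "f \<in> borel_measurable M" and pos: "measure M A > 0"
  shows "(\<integral>x. f x \<partial>uniform_measure M A) = (\<integral>x. indicator A x * f x \<partial>M) / measure M A"
proof -
  have "emeasure M A = ennreal (measure M A)"
    using pos by (intro emeasure_eq_ennreal_measure) (auto simp: measure_def)
  then have "indicator A x / emeasure M A = ennreal (indicator A x / measure M A)" for x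
    using pos divide_ennreal[of 1 "measure M A"] by (simp add: indicator_def)
  then have "uniform_measure M A = density M (\<lambda>x. ennreal (indicator A x / measure M A))"
    unfolding uniform_measure_def by presburger
  then have "(\<integral>x. f x \<partial>uniform_measure M A) = (\<integral>x. (indicator A x / measure M A) *\<^sub>R f x \<partial>M)"
    using A f pos by (simp add: integral_density)
  also have "\<dots> = (\<integral>x. (indicator A x * f x) / measure M A \<partial>M)" by simp
  finally show ?thesis by simp
qed

text \<open>This holds without boundedness: a real \<open>SUP\<close> without upper bounds takes one
  fixed default value, so it is constant on the set of unbounded families.\<close>

lemma borel_measurable_SUP_real:
  fixes f :: "nat \<Rightarrow> 'a \<Rightarrow> real"
  assumes [measurable]: "\<And>i. f i \<in> borel_measurable M"
  shows "(\<lambda>x. SUP i. f i x) \<in> borel_measurable M"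
proof -
  define k where "k = (LEAST z::real. False)"
  \<comment> \<open>Natural bounds keep the quantifier countable, so boundedness is a measurable
    condition.\<close>
  define B where "B x \<longleftrightarrow> (\<exists>n::nat. \<forall>i. f i x \<le> real n)" for x
  have [measurable]: "Measurable.pred M B" unfolding B_def by measurable
  have B: "B x \<longleftrightarrow> bdd_above (range (\<lambda>i. f i x))" for x
  proof
    assume "bdd_above (range (\<lambda>i. f i x))"
    then obtain b where b: "f i x \<le> b" for i by (auto simp: bdd_above_def)
    obtain n where "b \<le> real n" using real_arch_simple by blast
    then have "f i x \<le> real n" for i using b[of i] by linarith
    then show "B x" unfolding B_def by blast
  qed (auto simp: B_def bdd_above_def)
  \<comment> \<open>\<open>Sup\<close> on the reals is the \<open>LEAST\<close> upper bound; without
    any upper bound it becomes \<open>LEAST\<close> of the empty predicate, independently of the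
    family.\<close>
  have unbounded: "(SUP i. f i x) = k" if "\<not> B x" for x
  proof -
    have "(\<lambda>z. \<forall>y\<in>range (\<lambda>i. f i x). y \<le> z) = (\<lambda>z. False)"
      using that unfolding B bdd_above_def by (intro ext) blast
    then show ?thesis unfolding Sup_real_def k_def by (rule arg_cong)
  qed
  have "(\<lambda>x. SUP i. if B x then f i x else k) \<in> borel_measurable M"
  proof (rule borel_measurable_cSUP)
    fix x
    show "bdd_above (range (\<lambda>i. if B x then f i x else k))"
      using B[of x] by (cases "B x") auto
  qed measurable
  also have "(\<lambda>x. SUP i. if B x then f i x else k) = (\<lambda>x. SUP i. f i x)"
  proof
    show "(SUP i. if B x then f i x else k) = (SUP i. f i x)" for x
      using unbounded[of x] by (cases "B x") auto
  qed
  finally show ?thesis .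
qed

lemma borel_measurable_vec_lambda:
  fixes f :: "'n::finite \<Rightarrow> 'a \<Rightarrow> real"
  assumes [measurable]: "\<And>j. f j \<in> borel_measurable M"
  shows "(\<lambda>x. \<chi> j. f j x) \<in> borel_measurable M"
proof -
  have "(\<chi> j. f j x) = (\<Sum>j\<in>UNIV. f j x *\<^sub>R axis j 1)" for x
    using basis_expansion[of "\<chi> j. f j x"] by (simp add: scalar_mult_eq_scaleR)
  then show ?thesis by simp
qed

lemma borel_measurable_vec_nth [measurable]: "(\<lambda>x :: real^'n. x $ j) \<in> borel_measurable borel"
  by (intro borel_measurable_continuous_onI continuous_on_component continuous_on_id)

section \<open>Stationarity and tail of the max process\<close>

locale storm_process =
  tcf_process nrm \<alpha> M \<Theta> + pp: poisson_process N "intensity \<alpha> M \<Theta>" "\<lambda>i \<omega>. (U i \<omega>, T i \<omega>, \<lambda>l. \<Psi> i l \<omega>)"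
  for nrm :: "real^'n \<Rightarrow> real" and \<alpha> :: real
    and M :: "'a measure" and \<Theta> :: "int \<Rightarrow> 'a \<Rightarrow> real^'n"
    and N :: "'b measure" and U :: "nat \<Rightarrow> 'b \<Rightarrow> real" and T :: "nat \<Rightarrow> 'b \<Rightarrow> int"
    and \<Psi> :: "nat \<Rightarrow> int \<Rightarrow> 'b \<Rightarrow> real^'n"
begin

definition V :: "nat \<Rightarrow> 'b \<Rightarrow> real \<times> int \<times> (int \<Rightarrow> real^'n)" where
  "V i \<omega> = (U i \<omega>, T i \<omega>, \<lambda>l. \<Psi> i l \<omega>)"

abbreviation Z :: "int \<Rightarrow> 'b \<Rightarrow> real^'n" where
  "Z \<equiv> max_process nrm \<alpha> U T \<Psi>"

sublocale poi: poisson_process N \<mu> V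
  using pp.poisson_process_axioms by (simp add: V_def[abs_def])

lemma storm_V: "storm nrm \<alpha> (U i \<omega>) (T i \<omega>) (\<lambda>l. \<Psi> i l \<omega>) = Y (V i \<omega>)"
  by (simp add: Y_def V_def)

lemma Z_nth: "Z t \<omega> $ j = (SUP i. Y (V i \<omega>) t $ j)"
  by (simp add: max_process_def storm_V)

lemma measurable_Y_V [measurable]: "(\<lambda>\<omega>. Y (V i \<omega>) t) \<in> borel_measurable N"
  using measurable_compose[OF poi.measurable_V measurable_Y] by simp

lemma measurable_Z [measurable]: "Z t \<in> borel_measurable N"
proof -
  have "(\<lambda>\<omega>. \<chi> j. SUP i. Y (V i \<omega>) t $ j) \<in> borel_measurable N"
    by (intro borel_measurable_vec_lambda borel_measurable_SUP_real) measurable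
  also have "(\<lambda>\<omega>. \<chi> j. SUP i. Y (V i \<omega>) t $ j) = Z t"
    by (simp add: fun_eq_iff vec_eq_iff Z_nth)
  finally show ?thesis .
qed

text \<open>At each time the storms above level 1 have finite intensity, so almost surely finitely
  many occur and all others are bounded by \<open>c\<close>. Times are countable, so one null set
  serves all.\<close>

lemma AE_bdd: "AE \<omega> in N. \<forall>t j. bdd_above (range (\<lambda>i. Y (V i \<omega>) t $ j))"
proof -
  obtain c where c: "\<And>x. norm x \<le> c * nrm x" "c \<ge> 1"
    using norm_on_Rd_equivalent[OF nrm] by metis
  have "AE \<omega> in N. \<forall>t. finite {i. V i \<omega> \<in> {p \<in> space \<mu>. nrm (Y p t) > 1}}"
    unfolding AE_all_countable
  proof
    fix t
    have "{p \<in> space \<mu>. nrm (Y p t) > 1} \<in> sets \<mu>" by measurable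
    then show "AE \<omega> in N. finite {i. V i \<omega> \<in> {p \<in> space \<mu>. nrm (Y p t) > 1}}"
      by (rule poi.AE_finite_points) (simp add: emeasure_intensity_nrm)
  qed
  with AE_space show ?thesis
  proof eventually_elim
    case (elim \<omega>)
    show ?case
    proof (intro allI)
      fix t j
      let ?I = "{i. V i \<omega> \<in> {p \<in> space \<mu>. nrm (Y p t) > 1}}"
      have "Y (V i \<omega>) t $ j \<le> c" if "i \<notin> ?I" for i
      proof -
        have "Y (V i \<omega>) t $ j \<le> norm (Y (V i \<omega>) t)"
          using component_le_norm_cart[of "Y (V i \<omega>) t" j] by linarith
        also have "\<dots> \<le> c * nrm (Y (V i \<omega>) t)" by (rule c)
        also have "\<dots> \<le> c * 1"
          using that c(2) poi.V_space[OF elim(1), of i] by (intro mult_left_mono) auto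
        finally show ?thesis by simp
      qed
      then have "range (\<lambda>i. Y (V i \<omega>) t $ j) \<subseteq> (\<lambda>i. Y (V i \<omega>) t $ j) ` ?I \<union> {..c}"
        by auto
      moreover have "bdd_above ((\<lambda>i. Y (V i \<omega>) t $ j) ` ?I \<union> {..c})"
        using elim(2) by auto
      ultimately show "bdd_above (range (\<lambda>i. Y (V i \<omega>) t $ j))"
        by (rule bdd_above_mono[rotated])
    qed
  qed
qed

lemma Z_le_iff:
  assumes "\<forall>t j. bdd_above (range (\<lambda>i. Y (V i \<omega>) t $ j))"
  shows "Z t \<omega> \<le> z \<longleftrightarrow> (\<forall>i. Y (V i \<omega>) t \<le> z)"
  using assms by (auto simp: less_eq_vec_def Z_nth cSUP_le_iff)

text \<open>The event says that no point carries a storm violating the bounds on \<open>J\<close>.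
  Its probability depends only on the mass of such storms, finite or infinite, and this mass is
  shift invariant.\<close>

lemma prob_Z_le:
  assumes J: "finite J"
  shows "emeasure N {\<omega> \<in> space N. \<forall>j\<in>J. Z (j + h) \<omega> \<le> z j} = emeasure N {\<omega> \<in> space N. \<forall>j\<in>J. Z j \<omega> \<le> z j}"
proof -
  let ?A = "{y :: int \<Rightarrow> real^'n. \<exists>j\<in>J. \<not> y j \<le> z j}"
  have A: "?A \<in> sets path_space"
  proof -
    have "?A = {y \<in> space path_space. \<exists>j\<in>J. \<not> y j \<le> z j}" by (simp add: space_PiM)
    also have "\<dots> \<in> sets path_space" using J by measurable
    finally show ?thesis .
  qed
  have shift [measurable]: "(\<lambda>p t. Y p (t + h)) \<in> \<mu> \<rightarrow>\<^sub>M path_space" for h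
    by (rule measurable_PiM_single') auto
  have B: "{p \<in> space \<mu>. (\<lambda>t. Y p (t + h)) \<in> ?A} \<in> sets \<mu>" for h
    by (rule Collect_vimage_sets[OF shift A])
  have eq: "measure N {\<omega> \<in> space N. \<forall>j\<in>J. Z (j + h) \<omega> \<le> z j} =
      \<P>(\<omega> in N. \<forall>i. V i \<omega> \<notin> {p \<in> space \<mu>. (\<lambda>t. Y p (t + h)) \<in> ?A})" for h
  proof (rule pp.finite_measure_eq_AE)
    have "AE \<omega> in N. (\<forall>j\<in>J. Z (j + h) \<omega> \<le> z j) \<longleftrightarrow>
        (\<forall>i. V i \<omega> \<notin> {p \<in> space \<mu>. (\<lambda>t. Y p (t + h)) \<in> ?A})"
      using AE_bdd AE_space
    proof eventually_elim
      case (elim \<omega>)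
      then show ?case using poi.V_space[OF elim(2)] by (auto simp: Z_le_iff)
    qed
    then show "AE \<omega> in N. (\<omega> \<in> {\<omega> \<in> space N. \<forall>j\<in>J. Z (j + h) \<omega> \<le> z j}) =
        (\<omega> \<in> {\<omega> \<in> space N. \<forall>i. V i \<omega> \<notin> {p \<in> space \<mu>. (\<lambda>t. Y p (t + h)) \<in> ?A}})"
      by eventually_elim simp
    show "{\<omega> \<in> space N. \<forall>j\<in>J. Z (j + h) \<omega> \<le> z j} \<in> sets N" using J by measurable
    have "point_count V {p \<in> space \<mu>. (\<lambda>t. Y p (t + h)) \<in> ?A} \<in> borel_measurable N"
      using B by (rule poi.measurable_point_count)
    then show "{\<omega> \<in> space N. \<forall>i. V i \<omega> \<notin> {p \<in> space \<mu>. (\<lambda>t. Y p (t + h)) \<in> ?A}} \<in> sets N"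
      unfolding poi.count_eq_0[symmetric] by measurable
  qed
  \<comment> \<open>Written with \<open>t + 0\<close> so that \<open>eq\<close> can be applied for
    both shifts.\<close>
  have E: "emeasure \<mu> {p \<in> space \<mu>. (\<lambda>t. Y p (t + h)) \<in> ?A} = emeasure \<mu> {p \<in> space \<mu>. (\<lambda>t. Y p (t + 0)) \<in> ?A}"
    using emeasure_intensity_shift[OF A, of h] by simp
  have "measure N {\<omega> \<in> space N. \<forall>j\<in>J. Z (j + h) \<omega> \<le> z j} = measure N {\<omega> \<in> space N. \<forall>j\<in>J. Z (j + 0) \<omega> \<le> z j}"
    unfolding eq poi.prob_void[OF B] using E by (simp add: measure_def)
  then show ?thesis by (simp add: pp.emeasure_eq_measure)
qed

lemma stationary_Z: "stationary N Z"
  unfolding stationary_def time_series_def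
proof (intro conjI allI)
  fix h :: int
  have m: "(\<lambda>\<omega> t. Z (t + h) \<omega>) \<in> N \<rightarrow>\<^sub>M path_space" for h
    by (rule measurable_PiM_single') auto
  note m0 = m[of 0, simplified]
  show "distr N path_space (\<lambda>\<omega> t. Z (t + h) \<omega>) = distr N path_space (\<lambda>\<omega> t. Z t \<omega>)"
  proof (rule measure_eqI_PiM_atMost)
    have "prob_space (distr N path_space (\<lambda>\<omega> t. Z (t + h) \<omega>))"
      by (rule pp.prob_space_distr[OF m])
    then show "emeasure (distr N path_space (\<lambda>\<omega> t. Z (t + h) \<omega>)) UNIV \<noteq> \<infinity>"
      using prob_space.emeasure_space_1 by (fastforce simp: space_PiM)
    fix J :: "int set" and z :: "int \<Rightarrow> real^'n" assume J: "finite J"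
    have box: "{x. \<forall>j\<in>J. x j \<le> z j} \<in> sets path_space"
    proof -
      have "{x. \<forall>j\<in>J. x j \<le> z j} = {x\<in>space path_space. \<forall>j\<in>J. x j \<le> z j}" by (simp add: space_PiM)
      also have "\<dots> \<in> sets path_space" using J by measurable
      finally show ?thesis .
    qed
    show "emeasure (distr N path_space (\<lambda>\<omega> t. Z (t + h) \<omega>)) {x. \<forall>j\<in>J. x j \<le> z j} =
      emeasure (distr N path_space (\<lambda>\<omega> t. Z t \<omega>)) {x. \<forall>j\<in>J. x j \<le> z j}"
      using prob_Z_le[OF J, of h z]
      by (simp add: emeasure_distr[OF m box] emeasure_distr[OF m0 box] vimage_def Int_def conj_commute)
  qed simp_all
qed (auto intro: pp.prob_space_axioms)

section \<open>A single big jump: comparison of the maximum with its largest storm\<close>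

definition big :: "int set \<Rightarrow> real \<Rightarrow> (real \<times> int \<times> (int \<Rightarrow> real^'n)) set" where
  "big F e = {p \<in> space \<mu>. \<exists>t\<in>F. nrm (Y p t) > e}"

lemma big_sets [measurable]: "finite F \<Longrightarrow> big F e \<in> sets \<mu>"
  unfolding big_def by measurable

lemma emeasure_big_le:
  assumes F: "finite F" and e: "e > 0"
  shows "emeasure \<mu> (big F e) \<le> ennreal (real (card F) * e powr (- \<alpha>))"
proof -
  have "big F e = (\<Union>t\<in>F. {p \<in> space \<mu>. nrm (Y p t) > e})" by (auto simp: big_def)
  also have "emeasure \<mu> \<dots> \<le> (\<Sum>t\<in>F. emeasure \<mu> {p \<in> space \<mu>. nrm (Y p t) > e})"
    using F by (intro emeasure_subadditive_finite) auto
  also have "\<dots> = ennreal (real (card F) * e powr (- \<alpha>))"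
    using e by (simp add: emeasure_intensity_nrm ennreal_mult ennreal_of_nat_eq_real_of_nat)
  finally show ?thesis .
qed

lemma measure_big:
  assumes F: "finite F" and e: "e > 0"
  shows "emeasure \<mu> (big F e) < \<infinity>" "measure \<mu> (big F e) \<le> real (card F) * e powr (- \<alpha>)"
proof -
  show fin: "emeasure \<mu> (big F e) < \<infinity>"
    using emeasure_big_le[OF assms] by (auto simp: less_top[symmetric] top_unique)
  show "measure \<mu> (big F e) \<le> real (card F) * e powr (- \<alpha>)"
    using emeasure_big_le[OF assms] unfolding measure_def
    by (metis enn2real_leI mult_nonneg_nonneg of_nat_0_le_iff powr_ge_zero)
qed

text \<open>The common bound on the storms also bounds the supremum, so no exceptional null set
  enters.\<close>

lemma Z_none_big:
  assumes \<omega>: "\<omega> \<in> space N" and e: "e \<ge> 0" and c: "\<And>v. norm v \<le> c * nrm v" "c \<ge> 1"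
    and none: "\<And>i. V i \<omega> \<notin> big F e" and t: "t \<in> F"
  shows "\<bar>Z t \<omega> $ j\<bar> \<le> c * e"
proof -
  have Y0: "0 \<le> Y (V i \<omega>) t $ j" for i using Y_nonneg[OF poi.V_space[OF \<omega>]] .
  have Ye: "Y (V i \<omega>) t $ j \<le> c * e" for i
  proof -
    have "nrm (Y (V i \<omega>) t) \<le> e"
      using none[of i] t poi.V_space[OF \<omega>, of i] by (auto simp: big_def not_less)
    then have "c * nrm (Y (V i \<omega>) t) \<le> c * e" using c(2) by (intro mult_left_mono) auto
    then show ?thesis
      using component_le_norm_cart[of "Y (V i \<omega>) t" j] c(1)[of "Y (V i \<omega>) t"] by linarith
  qed
  have "Z t \<omega> $ j \<le> c * e" unfolding Z_nth using Ye by (intro cSUP_least) auto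
  moreover have "0 \<le> Z t \<omega> $ j"
  proof -
    have "Y (V 0 \<omega>) t $ j \<le> (SUP i. Y (V i \<omega>) t $ j)"
      using Ye by (intro cSUP_upper bdd_aboveI2) auto
    then show ?thesis unfolding Z_nth using Y0[of 0] by linarith
  qed
  ultimately show ?thesis by simp
qed

text \<open>In each coordinate the maximum of a nonnegative number and numbers in
  \<open>{0..c * e}\<close> exceeds the former by at most \<open>c * e\<close>.\<close>

lemma Z_unique_big:
  assumes bdd: "\<forall>t j. bdd_above (range (\<lambda>i. Y (V i \<omega>) t $ j))"
    and \<omega>: "\<omega> \<in> poi.unique_in (big F e)" and e: "e \<ge> 0" and c: "\<And>v. norm v \<le> c * nrm v" "c \<ge> 1"
    and t: "t \<in> F"
  shows "\<bar>(Z t \<omega> - Y (poi.first_in (big F e) \<omega>) t) $ j\<bar> \<le> c * e"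
proof -
  have sp: "\<omega> \<in> space N" using \<omega> by (rule poi.unique_in_space)
  define k where "k = (LEAST i. V i \<omega> \<in> big F e)"
  have first: "poi.first_in (big F e) \<omega> = V k \<omega>" by (simp add: poi.first_in_def k_def)
  have "V k \<omega> \<in> big F e" using poi.first_in_unique[OF \<omega>] first by simp
  then have others: "V i \<omega> \<notin> big F e" if "i \<noteq> k" for i
    using \<omega> that unfolding poi.unique_in_def by blast
  have Y0: "0 \<le> Y (V i \<omega>) t $ j" for i using Y_nonneg[OF poi.V_space[OF sp]] .
  have ce: "0 \<le> c * e" using c e by simp
  have "Y (V i \<omega>) t $ j \<le> Y (V k \<omega>) t $ j + c * e" for i
  proof (cases "i = k")
    case False
    have "nrm (Y (V i \<omega>) t) \<le> e"
      using others[OF False] t poi.V_space[OF sp, of i] by (auto simp: big_def not_less)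
    then have "c * nrm (Y (V i \<omega>) t) \<le> c * e" using c(2) by (intro mult_left_mono) auto
    then have "Y (V i \<omega>) t $ j \<le> c * e"
      using component_le_norm_cart[of "Y (V i \<omega>) t" j] c(1)[of "Y (V i \<omega>) t"] by linarith
    then show ?thesis using Y0[of k] by linarith
  qed (use ce in simp)
  then have "Z t \<omega> $ j \<le> Y (V k \<omega>) t $ j + c * e" unfolding Z_nth by (intro cSUP_least) auto
  moreover have "Y (V k \<omega>) t $ j \<le> Z t \<omega> $ j"
    unfolding Z_nth using bdd by (intro cSUP_upper) auto
  ultimately show ?thesis using ce by (simp add: first)
qed

lemma measurable_exceed:
  assumes [measurable]: "f \<in> borel_measurable path_space"
  shows "exceed f x \<in> borel_measurable path_space"
proof -
  have "{y \<in> space path_space. nrm (y 0) > x} \<in> sets path_space" by measurable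
  then have [measurable]: "(indicator {y. nrm (y 0) > x} :: _ \<Rightarrow> real) \<in> borel_measurable path_space"
    by (subst borel_measurable_indicator') (auto simp: space_PiM)
  show ?thesis unfolding exceed_def[abs_def] by measurable
qed

lemma measurable_Z_path [measurable]: "(\<lambda>\<omega> t. Z t \<omega>) \<in> N \<rightarrow>\<^sub>M path_space"
  by (rule measurable_PiM_single') auto

text \<open>\<open>l\<close> is the mass of the big points; only its order in x matters outside.
  With one big point \<open>exceed_stable\<close> applies, with several the error is at most
  \<open>C\<close>, and with none the maximum at time 0 stays below x. The factor
  \<open>exp (- l)\<close> is kept because the contribution of the lone storm is computed
  exactly.\<close>

lemma error_bound:
  assumes x: "x > 0" and d: "0 < \<delta>" "\<delta> < 1/2"
    and c: "c \<ge> 1" "\<And>v. norm v \<le> c * nrm v" "\<And>v e. (\<And>j. \<bar>v $ j\<bar> \<le> e) \<Longrightarrow> nrm v \<le> c * e"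
    and F: "finite F" "0 \<in> F" and f: "continuous_on UNIV f" and C: "\<And>y. \<bar>f y\<bar> \<le> C" and \<eta>: "\<eta> \<ge> 0"
  shows "\<exists>l\<ge>0. l \<le> real (card F) * (\<delta> / (c * c)) powr (- \<alpha>) * x powr (- \<alpha>) \<and>
    \<bar>(\<integral>\<omega>. exceed f x (\<lambda>t. Z t \<omega>) \<partial>N) - exp (- l) * (x powr (- \<alpha>) * (\<integral>\<omega>. f (\<lambda>t. \<Theta> t \<omega>) \<partial>M))\<bar> \<le>
    C * l\<^sup>2 + x powr (- \<alpha>) * (\<eta> + 2 * C * ((1 - 2 * \<delta>) powr (- \<alpha>) - (1 + \<delta>) powr (- \<alpha>)) +
      2 * C * \<P>(\<omega> in M. (\<lambda>t. \<Theta> t \<omega>) \<in> unstable F f (2 * c * \<delta>) \<eta>))"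
proof -
  have [measurable]: "f \<in> borel_measurable path_space" by (rule continuous_imp_measurable_path) fact
  have [measurable]: "exceed f x \<in> borel_measurable path_space" by (rule measurable_exceed) fact
  have C0: "C \<ge> 0" using C[of undefined] by linarith
  have exceed_le: "\<bar>exceed f x w\<bar> \<le> C" for w
    using C[of "normed w"] C0 by (simp add: exceed_def indicator_def)
  \<comment> \<open>One factor \<open>c\<close> is lost from \<open>nrm\<close> to coordinates and
    another on the way back, so that \<open>c * (c * e)\<close> is the error
    \<open>\<delta> * x\<close>.\<close>
  define e where "e = \<delta> * x / (c * c)"
  have e: "e > 0" using d x c(1) by (simp add: e_def)
  have ce: "c * (c * e) = \<delta> * x" using c(1) by (simp add: e_def)
  have dx: "0 < \<delta> * x" "\<delta> * x < x" using d x by auto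
  have "1 * e \<le> (c * c) * e" using c(1) e mult_mono[of 1 c 1 c] by (intro mult_right_mono) auto
  \<comment> \<open>Consequently every storm exceeding x at time 0 belongs to \<open>B\<close>, and
    restricting to \<open>B\<close> loses nothing of the main term.\<close>
  then have ex: "e < x" using ce dx(2) by (simp add: mult.assoc)
  define B where "B = big F e"
  have B [measurable]: "B \<in> sets \<mu>" unfolding B_def using F by measurable
  note fin = measure_big(1)[OF F(1) e, folded B_def]
  define l where "l = measure \<mu> B"
  define U where "U = poi.unique_in B"
  define W where "W = poi.first_in B"
  have [measurable]: "U \<in> sets N" "W \<in> N \<rightarrow>\<^sub>M \<mu>"
    unfolding U_def W_def by measurable
  define many where "many = {\<omega> \<in> space N. (\<exists>i. V i \<omega> \<in> B) \<and> \<omega> \<notin> U}"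
  have [measurable]: "many \<in> sets N" unfolding many_def by measurable
  \<comment> \<open>The three error terms of \<open>exceed_stable\<close> as sets of points;
    \<open>E1\<close>, \<open>E2\<close>, \<open>E3\<close> are the events that the lone big point
    falls into them.\<close>
  define D1 where "D1 = {p \<in> space \<mu>. nrm (Y p 0) > x}"
  define D2 where "D2 = {p \<in> space \<mu>. (1 - 2 * \<delta>) * x < nrm (Y p 0) \<and> nrm (Y p 0) \<le> (1 + \<delta>) * x}"
  define D3 where "D3 = {p \<in> space \<mu>. nrm (Y p 0) > x \<and> normed (Y p) \<in> unstable F f (2 * c * \<delta>) \<eta>}"
  have D1 [measurable]: "D1 \<in> sets \<mu>" unfolding D1_def by measurable
  have D2 [measurable]: "D2 \<in> sets \<mu>" unfolding D2_def by measurable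
  have un: "unstable F f (2 * c * \<delta>) \<eta> \<in> sets path_space"
    by (rule unstable_sets[OF F(1) f])
  have nY: "(\<lambda>p. normed (Y p)) \<in> \<mu> \<rightarrow>\<^sub>M path_space" by measurable
  have "D3 = D1 \<inter> {p \<in> space \<mu>. normed (Y p) \<in> unstable F f (2 * c * \<delta>) \<eta>}"
    by (auto simp: D3_def D1_def)
  with D1 Collect_vimage_sets[OF nY un] have D3 [measurable]: "D3 \<in> sets \<mu>" by auto
  have eD1: "emeasure \<mu> D1 = ennreal (x powr (- \<alpha>))"
    unfolding D1_def by (rule emeasure_intensity_nrm[OF x])
  have eD3: "emeasure \<mu> D3 = ennreal (x powr (- \<alpha>)) * emeasure M {\<omega> \<in> space M. (\<lambda>t. \<Theta> t \<omega>) \<in> unstable F f (2 * c * \<delta>) \<eta>}"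
    unfolding D3_def by (rule emeasure_intensity_normed[OF un x])
  have pos: "(1 - 2 * \<delta>) * x > 0" "(1 + \<delta>) * x > 0" using d x by auto
  have le: "(1 - 2 * \<delta>) * x \<le> (1 + \<delta>) * x" using d x by (intro mult_right_mono) auto
  let ?E = "\<lambda>r. {p \<in> space \<mu>. nrm (Y p 0) > r}"
  have E: "?E r \<in> sets \<mu>" for r by measurable
  have D2_eq: "D2 = ?E ((1 - 2 * \<delta>) * x) - ?E ((1 + \<delta>) * x)" by (auto simp: D2_def)
  have mE: "measure \<mu> (?E r) = r powr (- \<alpha>)" if "r > 0" for r
    using emeasure_intensity_nrm[OF that, of 0] by (simp add: measure_def)
  have mD2: "measure \<mu> D2 = ((1 - 2 * \<delta>) * x) powr (- \<alpha>) - ((1 + \<delta>) * x) powr (- \<alpha>)"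
    unfolding D2_eq using le E
    by (subst measure_Diff) (auto simp: emeasure_intensity_nrm[OF pos(1)] mE[OF pos(1)] mE[OF pos(2)])
  have fD: "emeasure \<mu> D1 < \<infinity>" "emeasure \<mu> D2 < \<infinity>" "emeasure \<mu> D3 < \<infinity>"
  proof -
    show "emeasure \<mu> D1 < \<infinity>" by (simp add: eD1)
    have "emeasure \<mu> D2 \<le> emeasure \<mu> (?E ((1 - 2 * \<delta>) * x))"
      unfolding D2_eq using E by (intro emeasure_mono) auto
    also have "\<dots> < \<infinity>" using emeasure_intensity_nrm[OF pos(1)] by simp
    finally show "emeasure \<mu> D2 < \<infinity>" .
    have "emeasure \<mu> D3 \<le> emeasure \<mu> D1" by (intro emeasure_mono) (auto simp: D1_def D3_def)
    then show "emeasure \<mu> D3 < \<infinity>" by (simp add: eD1 order_le_less_trans)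
  qed
  have mD1: "measure \<mu> D1 = x powr (- \<alpha>)" using eD1 by (simp add: measure_def)
  have mD3: "measure \<mu> D3 = x powr (- \<alpha>) * \<P>(\<omega> in M. (\<lambda>t. \<Theta> t \<omega>) \<in> unstable F f (2 * c * \<delta>) \<eta>)"
    unfolding measure_def eD3 by (simp add: enn2real_mult)
  define E1 where "E1 = {\<omega> \<in> U. W \<omega> \<in> D1}"
  define E2 where "E2 = {\<omega> \<in> U. W \<omega> \<in> D2}"
  define E3 where "E3 = {\<omega> \<in> U. W \<omega> \<in> D3}"
  have Ei: "{\<omega> \<in> U. W \<omega> \<in> D} \<in> sets N" if "D \<in> sets \<mu>" for D
  proof -
    have "{\<omega> \<in> U. W \<omega> \<in> D} = U \<inter> {\<omega> \<in> space N. W \<omega> \<in> D}"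
      by (auto simp: U_def dest: poi.unique_in_space)
    with that show ?thesis by simp
  qed
  have [measurable]: "E1 \<in> sets N" "E2 \<in> sets N" "E3 \<in> sets N"
    unfolding E1_def E2_def E3_def using D1 D2 D3 by (auto intro: Ei)
  \<comment> \<open>\<open>?H\<close> replaces the maximum by the lone big storm and is 0 on
    \<open>many\<close>, which accounts for the term with \<open>C\<close>.\<close>
  let ?G = "\<lambda>\<omega>. exceed f x (\<lambda>t. Z t \<omega>)" and ?H = "\<lambda>\<omega>. indicator U \<omega> * exceed f x (Y (W \<omega>))"
  let ?R = "\<lambda>\<omega>. C * indicator many \<omega> + \<eta> * indicator E1 \<omega> + 2 * C * indicator E2 \<omega> + 2 * C * indicator E3 \<omega>"
  have bound: "AE \<omega> in N. \<bar>?G \<omega> - ?H \<omega>\<bar> \<le> ?R \<omega>"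
    using AE_bdd AE_space
  proof eventually_elim
    case (elim \<omega>)
    consider "\<omega> \<in> U" | "\<omega> \<in> many" "\<omega> \<notin> U" | "\<And>i. V i \<omega> \<notin> B" "\<omega> \<notin> U" "\<omega> \<notin> many"
      using elim(2) by (auto simp: many_def)
    then show ?case
    proof cases
      case 1
      then have WB: "W \<omega> \<in> B" unfolding U_def W_def by (rule poi.first_in_unique)
      then have Wsp: "W \<omega> \<in> space \<mu>" using sets.sets_into_space[OF B] by auto
      have "nrm (Z j \<omega> - Y (W \<omega>) j) \<le> \<delta> * x" if "j \<in> F" for j
        using c(3)[of "Z j \<omega> - Y (W \<omega>) j" "c * e"] Z_unique_big[OF elim(1) 1[unfolded U_def B_def] _ c(2,1) that] e
        unfolding ce by (simp add: W_def B_def)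
      note st = exceed_stable[OF x d c(1,2) F(2), where f = f and z = "\<lambda>t. Z t \<omega>" and y = "Y (W \<omega>)", OF this C \<eta>]
      have i: "indicator {y. nrm (y 0) > x} (Y (W \<omega>)) = (indicator E1 \<omega> :: real)"
        "indicator {y. (1 - 2 * \<delta>) * x < nrm (y 0) \<and> nrm (y 0) \<le> (1 + \<delta>) * x} (Y (W \<omega>)) = (indicator E2 \<omega> :: real)"
        "indicator {y. nrm (y 0) > x \<and> normed y \<in> unstable F f (2 * c * \<delta>) \<eta>} (Y (W \<omega>)) = (indicator E3 \<omega> :: real)"
        using 1 Wsp by (simp_all add: E1_def E2_def E3_def D1_def D2_def D3_def indicator_def)
      have "\<omega> \<notin> many" using 1 by (simp add: many_def)
      then show ?thesis using st[unfolded i] 1 by simp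
    next
      case 2
      then show ?thesis using exceed_le[of "\<lambda>t. Z t \<omega>"] by (simp add: E1_def E2_def E3_def)
    next
      case 3
      have "nrm (Z 0 \<omega>) \<le> c * (c * e)"
        using Z_none_big[OF elim(2) _ c(2,1) 3(1)[unfolded B_def] F(2)] e by (intro c(3)) simp
      then have "nrm (Z 0 \<omega>) < x" using dx ce by linarith
      then show ?thesis using 3 by (simp add: exceed_def E1_def E2_def E3_def)
    qed
  qed
  have G_int: "integrable N ?G"
    using exceed_le by (intro pp.integrable_const_bound[where B = C]) auto
  have H_int: "integrable N ?H"
    using exceed_le C0 by (intro pp.integrable_const_bound[where B = C]) (auto simp: indicator_def)
  have R_int: "integrable N ?R"
    by (intro Bochner_Integration.integrable_add integrable_mult_right integrable_real_indicator) (auto simp: less_top[symmetric])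
  have "\<bar>integral\<^sup>L N ?G - integral\<^sup>L N ?H\<bar> = \<bar>\<integral>\<omega>. ?G \<omega> - ?H \<omega> \<partial>N\<bar>"
    using G_int H_int by simp
  also have "\<dots> \<le> (\<integral>\<omega>. \<bar>?G \<omega> - ?H \<omega>\<bar> \<partial>N)" by (rule integral_abs_bound)
  also have "\<dots> \<le> integral\<^sup>L N ?R"
    using G_int H_int R_int bound by (intro integral_mono_AE) auto
  also have "\<dots> = C * measure N many + \<eta> * measure N E1 + 2 * C * measure N E2 + 2 * C * measure N E3"
    by (simp add: integrable_real_indicator less_top[symmetric])
  also have "\<dots> \<le> C * l\<^sup>2 + \<eta> * measure \<mu> D1 + 2 * C * measure \<mu> D2 + 2 * C * measure \<mu> D3"
    using \<eta> C0 poi.prob_many_le[OF B fin] poi.prob_first_in_le[OF B fin D1 fD(1)]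
      poi.prob_first_in_le[OF B fin D2 fD(2)] poi.prob_first_in_le[OF B fin D3 fD(3)]
    by (intro add_mono mult_left_mono) (simp_all add: many_def U_def W_def E1_def E2_def E3_def l_def)
  also have "\<dots> = C * l\<^sup>2 + x powr (- \<alpha>) * (\<eta> + 2 * C * ((1 - 2 * \<delta>) powr (- \<alpha>) - (1 + \<delta>) powr (- \<alpha>)) +
      2 * C * \<P>(\<omega> in M. (\<lambda>t. \<Theta> t \<omega>) \<in> unstable F f (2 * c * \<delta>) \<eta>))"
  proof -
    have "((1 - 2 * \<delta>) * x) powr (- \<alpha>) = (1 - 2 * \<delta>) powr (- \<alpha>) * x powr (- \<alpha>)"
      "((1 + \<delta>) * x) powr (- \<alpha>) = (1 + \<delta>) powr (- \<alpha>) * x powr (- \<alpha>)"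
      using d x by (simp_all add: powr_mult)
    then show ?thesis unfolding mD1 mD2 mD3 by (simp only: ring_distribs) (simp add: mult_ac)
  qed
  also have "integral\<^sup>L N ?H = exp (- l) * (x powr (- \<alpha>) * (\<integral>\<omega>. f (\<lambda>t. \<Theta> t \<omega>) \<partial>M))"
  proof -
    have "(\<lambda>p. exceed f x (Y p)) \<in> borel_measurable \<mu>" by measurable
    from poi.integral_first_in[OF B fin this]
    have "integral\<^sup>L N ?H = exp (- l) * (\<integral>p. indicator B p * exceed f x (Y p) \<partial>\<mu>)"
      by (simp add: U_def W_def l_def)
    also have "(\<integral>p. indicator B p * exceed f x (Y p) \<partial>\<mu>) = (\<integral>p. indicator {p. nrm (Y p 0) > x} p * f (normed (Y p)) \<partial>\<mu>)"
    proof (rule Bochner_Integration.integral_cong[OF refl])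
      fix p assume p: "p \<in> space \<mu>"
      have "p \<in> B" if "nrm (Y p 0) > x"
        using that ex F(2) p by (auto simp: B_def big_def intro!: bexI[of _ 0])
      then show "indicator B p * exceed f x (Y p) = indicator {p. nrm (Y p 0) > x} p * f (normed (Y p))"
        by (auto simp: exceed_def indicator_def)
    qed
    also have "\<dots> = x powr (- \<alpha>) * (\<integral>\<omega>. f (\<lambda>t. \<Theta> t \<omega>) \<partial>M)"
      by (rule integral_normed[OF _ x]) measurable
    finally show ?thesis .
  qed
  finally have main: "\<bar>integral\<^sup>L N ?G - exp (- l) * (x powr (- \<alpha>) * (\<integral>\<omega>. f (\<lambda>t. \<Theta> t \<omega>) \<partial>M))\<bar> \<le>
    C * l\<^sup>2 + x powr (- \<alpha>) * (\<eta> + 2 * C * ((1 - 2 * \<delta>) powr (- \<alpha>) - (1 + \<delta>) powr (- \<alpha>)) +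
      2 * C * \<P>(\<omega> in M. (\<lambda>t. \<Theta> t \<omega>) \<in> unstable F f (2 * c * \<delta>) \<eta>))" .
  have "l \<le> real (card F) * (\<delta> / (c * c)) powr (- \<alpha>) * x powr (- \<alpha>)"
  proof -
    have "e powr (- \<alpha>) = (\<delta> / (c * c)) powr (- \<alpha>) * x powr (- \<alpha>)"
      using d x c(1) unfolding e_def by (subst powr_mult[symmetric]) (auto simp: field_simps)
    then show ?thesis using measure_big(2)[OF F(1) e] by (simp add: l_def B_def mult.assoc)
  qed
  with main show ?thesis by (intro exI[of _ l]) (simp add: l_def)
qed

text \<open>For fixed \<delta> the mass l is of order \<open>x powr (- \<alpha>)\<close>; after
  multiplication by \<open>x powr \<alpha>\<close> the square of l and the loss
  \<open>1 - exp (- l)\<close> both vanish as x grows. The remaining errors have been made small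
  through \<delta>.\<close>

lemma tail_limit:
  assumes F: "finite F" "0 \<in> F" and f: "continuous_on UNIV f" and C: "\<And>y. \<bar>f y\<bar> \<le> C"
    and dep: "\<And>x y. (\<And>j. j \<in> F \<Longrightarrow> x j = y j) \<Longrightarrow> f x = f y"
  shows "((\<lambda>x. x powr \<alpha> * (\<integral>\<omega>. exceed f x (\<lambda>t. Z t \<omega>) \<partial>N)) \<longlongrightarrow> (\<integral>\<omega>. f (\<lambda>t. \<Theta> t \<omega>) \<partial>M)) at_top"
proof (rule tendstoI)
  fix \<epsilon> :: real assume \<epsilon>: "\<epsilon> > 0"
  define I where "I = (\<integral>\<omega>. f (\<lambda>t. \<Theta> t \<omega>) \<partial>M)"
  have [measurable]: "f \<in> borel_measurable path_space" by (rule continuous_imp_measurable_path) fact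
  have C0: "C \<ge> 0" using C[of undefined] by linarith
  have "norm I \<le> (\<integral>\<omega>. norm (f (\<lambda>t. \<Theta> t \<omega>)) \<partial>M)" unfolding I_def by (rule integral_norm_bound)
  also have "\<dots> \<le> (\<integral>\<omega>. C \<partial>M)"
    using C C0 by (intro integral_mono integrable_const_bound[where B = C]) auto
  finally have I: "\<bar>I\<bar> \<le> C" by (simp add: prob_space)
  obtain c where c: "c \<ge> 1" "\<And>v. norm v \<le> c * nrm v" "\<And>v e. (\<And>j. \<bar>v $ j\<bar> \<le> e) \<Longrightarrow> nrm v \<le> c * e"
    using norm_on_Rd_equivalent[OF nrm] by metis
  \<comment> \<open>Chosen so that \<open>2 * c * \<delta> n\<close> is
    \<open>1 / real (Suc n)\<close>, the scale in \<open>unstable_Inter\<close>.\<close>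
  define \<delta> where "\<delta> n = 1 / real (Suc n) / (2 * c)" for n
  let ?P = "\<lambda>n. \<P>(\<omega> in M. (\<lambda>t. \<Theta> t \<omega>) \<in> unstable F f (2 * c * \<delta> n) (\<epsilon> / 4))"
  define R where "R n = 2 * C * ((1 - 2 * \<delta> n) powr (- \<alpha>) - (1 + \<delta> n) powr (- \<alpha>)) + 2 * C * ?P n" for n
  have \<delta>0: "\<delta> \<longlonglongrightarrow> 0"
  proof -
    have "(\<lambda>n. 1 / real (Suc n) / (2 * c)) \<longlonglongrightarrow> 0 / (2 * c)"
      using LIMSEQ_inverse_real_of_nat c(1) by (intro tendsto_divide tendsto_const) (auto simp: inverse_eq_divide)
    then show ?thesis by (simp add: \<delta>_def[abs_def])
  qed
  have P0: "?P \<longlonglongrightarrow> 0"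
  proof -
    let ?A = "\<lambda>n. {\<omega> \<in> space M. (\<lambda>t. \<Theta> t \<omega>) \<in> unstable F f (1 / real (Suc n)) (\<epsilon> / 4)}"
    have "(\<lambda>n. prob (?A n)) \<longlonglongrightarrow> prob (\<Inter>n. ?A n)"
    proof (rule finite_Lim_measure_decseq)
      show "range ?A \<subseteq> sets M"
        using Collect_vimage_sets[OF measurable_Theta_path' unstable_sets[OF F(1) f]] by auto
      have "unstable F f (1 / real (Suc n)) (\<epsilon> / 4) \<subseteq> unstable F f (1 / real (Suc m)) (\<epsilon> / 4)" if "m \<le> n" for m n
        using that by (intro unstable_mono divide_left_mono) auto
      then show "decseq ?A" unfolding decseq_def by blast
    qed
    moreover have "(\<Inter>n. ?A n) = {}"
      using unstable_Inter[OF f _ dep, of "\<epsilon> / 4" F] \<epsilon> by auto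
    moreover have "2 * c * \<delta> n = 1 / real (Suc n)" for n using c(1) by (simp add: \<delta>_def)
    ultimately show ?thesis by simp
  qed
  have "R \<longlonglongrightarrow> 2 * C * ((1 - 2 * 0) powr (- \<alpha>) - (1 + 0) powr (- \<alpha>)) + 2 * C * 0"
    unfolding R_def[abs_def] by (intro tendsto_intros \<delta>0 P0) auto
  then have "R \<longlonglongrightarrow> 0" by simp
  then have "\<forall>\<^sub>F n in sequentially. R n < \<epsilon> / 4"
    using \<epsilon> by (intro order_tendstoD) auto
  \<comment> \<open>At \<open>n = 0\<close> and \<open>c = 1\<close> one would get \<delta> equal to
    1/2, which the strict bound excludes.\<close>
  then have "\<forall>\<^sub>F n in sequentially. R n < \<epsilon> / 4 \<and> n \<ge> 1"
    using eventually_ge_at_top[of 1] by eventually_elim simp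
  then obtain n where n: "R n < \<epsilon> / 4" "n \<ge> 1" by (auto simp: eventually_sequentially)
  have d: "0 < \<delta> n" "\<delta> n < 1/2"
  proof -
    show "0 < \<delta> n" using c(1) by (simp add: \<delta>_def)
    define r where "r = real (Suc n)"
    have r: "1 < r" using n(2) by (simp add: r_def)
    also have "r * 1 \<le> r * c" using c(1) r by (intro mult_left_mono) auto
    finally have "1 / r / (2 * c) < 1 / 2" using c(1) r by (simp add: field_simps)
    then show "\<delta> n < 1/2" by (simp add: \<delta>_def r_def)
  qed
  define q where "q = real (card F) * (\<delta> n / (c * c)) powr (- \<alpha>)"
  have q0: "q \<ge> 0" by (simp add: q_def)
  have pow0: "((\<lambda>x. x powr (- \<alpha>)) \<longlongrightarrow> 0) at_top"
    using alpha by (intro tendsto_neg_powr filterlim_ident) auto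
  have "((\<lambda>x. C * q\<^sup>2 * x powr (- \<alpha>) + C * q * x powr (- \<alpha>)) \<longlongrightarrow> C * q\<^sup>2 * 0 + C * q * 0) at_top"
    by (intro tendsto_intros pow0)
  then have small: "\<forall>\<^sub>F x in at_top. C * q\<^sup>2 * x powr (- \<alpha>) + C * q * x powr (- \<alpha>) < \<epsilon> / 4"
    using \<epsilon> by (intro order_tendstoD) auto
  \<comment> \<open>The budget is \<epsilon>/4 for the oscillation tolerated by
    \<open>unstable\<close>, \<epsilon>/4 for \<open>R n\<close> and \<epsilon>/4 for the terms in
    \<open>small\<close>.\<close>
  show "\<forall>\<^sub>F x in at_top. dist (x powr \<alpha> * (\<integral>\<omega>. exceed f x (\<lambda>t. Z t \<omega>) \<partial>N)) (\<integral>\<omega>. f (\<lambda>t. \<Theta> t \<omega>) \<partial>M) < \<epsilon>"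
    using small eventually_gt_at_top[of 0]
  proof eventually_elim
    case (elim x)
    let ?K = "\<integral>\<omega>. exceed f x (\<lambda>t. Z t \<omega>) \<partial>N"
    have cancel: "x powr \<alpha> * x powr (- \<alpha>) = 1" using elim(2) by (simp add: powr_minus)
    obtain l where l: "l \<ge> 0" "l \<le> q * x powr (- \<alpha>)"
      and bound: "\<bar>?K - exp (- l) * (x powr (- \<alpha>) * I)\<bar> \<le> C * l\<^sup>2 + x powr (- \<alpha>) * (\<epsilon> / 4 + R n)"
      using error_bound[OF elim(2) d c F f C, of "\<epsilon> / 4"] \<epsilon> unfolding q_def I_def R_def by (auto simp: add.assoc)
    have "\<bar>x powr \<alpha> * ?K - exp (- l) * I\<bar> = x powr \<alpha> * \<bar>?K - exp (- l) * (x powr (- \<alpha>) * I)\<bar>"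
    proof -
      have "x powr \<alpha> * ?K - exp (- l) * I = x powr \<alpha> * ?K - exp (- l) * ((x powr \<alpha> * x powr (- \<alpha>)) * I)"
        unfolding cancel by simp
      also have "\<dots> = x powr \<alpha> * (?K - exp (- l) * (x powr (- \<alpha>) * I))" by (simp add: algebra_simps)
      finally show ?thesis by (simp add: abs_mult)
    qed
    also have "\<dots> \<le> x powr \<alpha> * (C * l\<^sup>2 + x powr (- \<alpha>) * (\<epsilon> / 4 + R n))"
      by (intro mult_left_mono bound) simp
    also have "\<dots> = C * (x powr \<alpha> * l\<^sup>2) + (x powr \<alpha> * x powr (- \<alpha>)) * (\<epsilon> / 4 + R n)"
      by (simp add: algebra_simps)
    also have "x powr \<alpha> * l\<^sup>2 \<le> q\<^sup>2 * x powr (- \<alpha>)"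
    proof -
      have "l\<^sup>2 \<le> (q * x powr (- \<alpha>))\<^sup>2" using l by (intro power_mono) auto
      then have "x powr \<alpha> * l\<^sup>2 \<le> x powr \<alpha> * (q * x powr (- \<alpha>))\<^sup>2" by (intro mult_left_mono) auto
      also have "\<dots> = q\<^sup>2 * (x powr \<alpha> * x powr (- \<alpha>)) * x powr (- \<alpha>)"
        by (simp add: power2_eq_square mult_ac)
      finally show ?thesis unfolding cancel by simp
    qed
    finally have 1: "\<bar>x powr \<alpha> * ?K - exp (- l) * I\<bar> \<le> C * (q\<^sup>2 * x powr (- \<alpha>)) + (\<epsilon> / 4 + R n)"
      unfolding cancel using C0 by (simp add: mult_left_mono)
    have "\<bar>exp (- l) * I - I\<bar> = (1 - exp (- l)) * \<bar>I\<bar>"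
    proof -
      have "exp (- l) * I - I = - ((1 - exp (- l)) * I)" by (simp add: algebra_simps)
      then show ?thesis using l(1) by (simp add: abs_mult)
    qed
    also have "\<dots> \<le> l * C"
      using exp_ge_add_one_self[of "- l"] l(1) I by (intro mult_mono) auto
    also have "\<dots> \<le> (q * x powr (- \<alpha>)) * C" using l C0 by (intro mult_right_mono) auto
    finally have "\<bar>exp (- l) * I - I\<bar> \<le> C * q * x powr (- \<alpha>)" by (simp add: mult_ac)
    with 1 elim(1) n(1) \<epsilon> have "\<bar>x powr \<alpha> * ?K - I\<bar> < \<epsilon>" by (simp add: mult.assoc)
    then show ?case by (simp add: dist_real_def I_def)
  qed
qed

text \<open>A conditional expectation is a quotient: \<open>tail_limit\<close> gives the numerator
  and, for the constant 1, the denominator. The latter limit also makes the conditioning event have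
  positive probability for all large x.\<close>

lemma spectral_tail: "spectral_tail_process nrm N Z M \<Theta>"
  unfolding spectral_tail_process_def
proof (intro conjI allI impI)
  show "stationary N Z" by (rule stationary_Z)
  show "time_series M \<Theta>" using TCF by (simp add: property_TCF_def)
  fix s t :: int assume "s \<le> t"
  show "weakly_converges (block_topology s t)
      (\<lambda>x. distr (uniform_measure N {\<omega> \<in> space N. nrm (Z 0 \<omega>) > x}) (block_space s t)
        (\<lambda>\<omega>. \<lambda>j\<in>{s..t}. Z j \<omega> /\<^sub>R nrm (Z 0 \<omega>)))
      (distr M (block_space s t) (\<lambda>\<omega>. \<lambda>j\<in>{s..t}. \<Theta> j \<omega>)) at_top"
    unfolding weakly_converges_def
  proof (intro allI impI)
    fix f :: "(int \<Rightarrow> real^'n) \<Rightarrow> real"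
    assume f: "bounded_continuous_map (block_topology s t) f"
    then have cont: "continuous_map (block_topology s t) euclideanreal f"
      and bdd: "bounded (f ` topspace (block_topology s t))"
      by (auto simp: bounded_continuous_map_def)
    have fm [measurable]: "f \<in> borel_measurable (block_space s t)"
      by (rule continuous_map_block_imp_measurable[OF cont])
    define g where "g y = f (restrict y {s..t})" for y
    have g_cont: "continuous_on UNIV g"
      unfolding g_def[abs_def] by (rule continuous_map_block_imp_continuous_on[OF cont])
    obtain C where C: "\<And>y. \<bar>g y\<bar> \<le> C"
    proof -
      obtain C where "\<forall>v\<in>f ` topspace (block_topology s t). norm v \<le> C"
        using bdd unfolding bounded_iff by blast
      then have "\<bar>g y\<bar> \<le> C" for y
        by (auto simp: g_def block_topology_def)
      then show thesis by (rule that)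
    qed
    \<comment> \<open>Time 0 is added because the block may miss it, while both the conditioning
      event and the normalisation refer to it.\<close>
    have dep: "g x = g y" if "\<And>j. j \<in> insert 0 {s..t} \<Longrightarrow> x j = y j" for x y
      unfolding g_def using that by (intro arg_cong[where f = f]) auto
    have lim_g: "((\<lambda>x. x powr \<alpha> * (\<integral>\<omega>. exceed g x (\<lambda>t. Z t \<omega>) \<partial>N)) \<longlongrightarrow> (\<integral>\<omega>. g (\<lambda>t. \<Theta> t \<omega>) \<partial>M)) at_top"
      by (rule tail_limit[of "insert 0 {s..t}", OF _ _ g_cont C dep]) auto
    let ?A = "\<lambda>x. {\<omega> \<in> space N. nrm (Z 0 \<omega>) > x}"
    have A: "?A x \<in> sets N" for x by measurable
    have "((\<lambda>x. x powr \<alpha> * (\<integral>\<omega>. exceed (\<lambda>_. 1) x (\<lambda>t. Z t \<omega>) \<partial>N)) \<longlongrightarrow> (\<integral>\<omega>. 1 \<partial>M)) at_top"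
      by (rule tail_limit[of "{0}" _ 1]) auto
    moreover have "(\<integral>\<omega>. exceed (\<lambda>_. 1) x (\<lambda>t. Z t \<omega>) \<partial>N) = measure N (?A x)" for x
    proof -
      have "(\<integral>\<omega>. exceed (\<lambda>_. 1) x (\<lambda>t. Z t \<omega>) \<partial>N) = (\<integral>\<omega>. indicator (?A x) \<omega> \<partial>N)"
        by (intro Bochner_Integration.integral_cong) (auto simp: exceed_def indicator_def)
      then show ?thesis using A[of x] by simp
    qed
    ultimately have lim_1: "((\<lambda>x. x powr \<alpha> * measure N (?A x)) \<longlongrightarrow> 1) at_top"
      by (simp add: prob_space)
    have quotient: "((\<lambda>x. (x powr \<alpha> * (\<integral>\<omega>. exceed g x (\<lambda>t. Z t \<omega>) \<partial>N)) / (x powr \<alpha> * measure N (?A x))) \<longlongrightarrow>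
        (\<integral>\<omega>. g (\<lambda>t. \<Theta> t \<omega>) \<partial>M) / 1) at_top"
      by (intro tendsto_divide lim_g lim_1) auto
    have "\<forall>\<^sub>F x in at_top. x powr \<alpha> * measure N (?A x) > 0"
      using lim_1 by (rule order_tendstoD) simp
    then have ev: "\<forall>\<^sub>F x in at_top. (x powr \<alpha> * (\<integral>\<omega>. exceed g x (\<lambda>t. Z t \<omega>) \<partial>N)) / (x powr \<alpha> * measure N (?A x)) =
      (\<integral>y. f y \<partial>distr (uniform_measure N (?A x)) (block_space s t) (\<lambda>\<omega>. \<lambda>j\<in>{s..t}. Z j \<omega> /\<^sub>R nrm (Z 0 \<omega>)))"
      using eventually_gt_at_top[of 0]
    proof eventually_elim
      case (elim x)
      then have pos: "measure N (?A x) > 0" by (simp add: zero_less_mult_iff)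
      have m: "(\<lambda>\<omega>. \<lambda>j\<in>{s..t}. Z j \<omega> /\<^sub>R nrm (Z 0 \<omega>)) \<in> N \<rightarrow>\<^sub>M block_space s t"
        unfolding block_space_def by (intro measurable_restrict) measurable
      have "(\<integral>y. f y \<partial>distr (uniform_measure N (?A x)) (block_space s t) (\<lambda>\<omega>. \<lambda>j\<in>{s..t}. Z j \<omega> /\<^sub>R nrm (Z 0 \<omega>))) =
        (\<integral>\<omega>. f (\<lambda>j\<in>{s..t}. Z j \<omega> /\<^sub>R nrm (Z 0 \<omega>)) \<partial>uniform_measure N (?A x))"
        using m by (intro integral_distr fm) simp
      also have "\<dots> = (\<integral>\<omega>. indicator (?A x) \<omega> * f (\<lambda>j\<in>{s..t}. Z j \<omega> /\<^sub>R nrm (Z 0 \<omega>)) \<partial>N) / measure N (?A x)"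
        using measurable_compose[OF m fm] by (intro integral_uniform_measure A pos)
      also have "(\<integral>\<omega>. indicator (?A x) \<omega> * f (\<lambda>j\<in>{s..t}. Z j \<omega> /\<^sub>R nrm (Z 0 \<omega>)) \<partial>N) = (\<integral>\<omega>. exceed g x (\<lambda>t. Z t \<omega>) \<partial>N)"
        by (intro Bochner_Integration.integral_cong) (auto simp: exceed_def indicator_def g_def normed_def[abs_def])
      finally have *: "(\<integral>y. f y \<partial>distr (uniform_measure N (?A x)) (block_space s t)
          (\<lambda>\<omega>. \<lambda>j\<in>{s..t}. Z j \<omega> /\<^sub>R nrm (Z 0 \<omega>))) =
        (\<integral>\<omega>. exceed g x (\<lambda>t. Z t \<omega>) \<partial>N) / measure N (?A x)" .
      show ?case unfolding * using elim(2) by simp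
    qed
    have rhs: "(\<integral>y. f y \<partial>distr M (block_space s t) (\<lambda>\<omega>. \<lambda>j\<in>{s..t}. \<Theta> j \<omega>)) = (\<integral>\<omega>. g (\<lambda>t. \<Theta> t \<omega>) \<partial>M)"
    proof -
      have m: "(\<lambda>\<omega>. \<lambda>j\<in>{s..t}. \<Theta> j \<omega>) \<in> M \<rightarrow>\<^sub>M block_space s t"
        unfolding block_space_def by (intro measurable_restrict) measurable
      show ?thesis using integral_distr[OF m fm] by (simp add: g_def)
    qed
    show "((\<lambda>x. \<integral>y. f y \<partial>distr (uniform_measure N (?A x)) (block_space s t)
        (\<lambda>\<omega>. \<lambda>j\<in>{s..t}. Z j \<omega> /\<^sub>R nrm (Z 0 \<omega>))) \<longlongrightarrow>
        (\<integral>y. f y \<partial>distr M (block_space s t) (\<lambda>\<omega>. \<lambda>j\<in>{s..t}. \<Theta> j \<omega>))) at_top"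
      using Lim_transform_eventually[OF quotient ev] unfolding rhs div_by_1 .
  qed
qed

end

theorem corollary3p3:
  fixes nrm :: "real^'n \<Rightarrow> real" and \<alpha> :: real
    and M :: "'a measure" and \<Theta> :: "int \<Rightarrow> 'a \<Rightarrow> real^'n"
    and N :: "'b measure" and U :: "nat \<Rightarrow> 'b \<Rightarrow> real" and T :: "nat \<Rightarrow> 'b \<Rightarrow> int"
    and \<Psi> :: "nat \<Rightarrow> int \<Rightarrow> 'b \<Rightarrow> real^'n"
  assumes "norm_on_Rd nrm"
    and "\<alpha> > 0"
    and "prob_space M"
    and "\<And>t. \<Theta> t \<in> M \<rightarrow>\<^sub>M nonneg_borel"
    and "property_SC nrm \<alpha> M \<Theta>"
    and "property_TCF nrm \<alpha> M \<Theta>"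
    and "poisson_points N (intensity \<alpha> M \<Theta>) (\<lambda>i \<omega>. (U i \<omega>, T i \<omega>, \<lambda>l. \<Psi> i l \<omega>))"
  shows "(AE \<omega> in N. \<forall>t j. bdd_above
            (range (\<lambda>i. storm nrm \<alpha> (U i \<omega>) (T i \<omega>) (\<lambda>l. \<Psi> i l \<omega>) t $ j))) \<and>
         spectral_tail_process nrm N (max_process nrm \<alpha> U T \<Psi>) M \<Theta>"
proof -
  have "prob_space N" using assms(7) by (simp add: poisson_points_def)
  then interpret storm_process nrm \<alpha> M \<Theta> N U T \<Psi>
    using assms by (simp add: storm_process_def tcf_process_def poisson_process_def poisson_process_axioms_def)
  show ?thesis
    using AE_bdd spectral_tail by (simp add: storm_V)
qed

end
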